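(* Let $\Delta$ be an $s\times r$ matrix of holomorphic functions on an open set $E\subset\mathbb{C}^d$ such that $B_\Delta$ is a domain (open and connected) in $\mathbb{C}^d$ with more than one point. Then the following conditions are equivalent: (1) $d_\Delta=d_{B_\Delta}$ on $B_\Delta\times B_\Delta$. (2) If a diagonalizable $d$-tuple $T$ of operators acting on $\mathbb{C}^2$ with $\sigma(T)\subset B_\Delta$ satisfies $\|\Delta(T)\|\le 1$, then $B_\Delta$ is a complete spectral domain for $T$.
   Context: $B_\Delta:=\{z\in E : \|\Delta(z)\|<1\}$, with the operator norm on $B(\mathbb{C}^r,\mathbb{C}^s)$. For $z,w\in B_\Delta$, $$d_\Delta(z,w):=\left\|(I-\Delta(w)\Delta(w)^* )^{-1/2}(\Delta(z)-\Delta(w))(I-\Delta(w)^*\Delta(z))^{-1}(I-\Delta(w)^*\Delta(w))^{1/2}\right\|.$$ Let $\mathbb{D}$ be the open unit disk and $d_{\mathbb{D}}(\alpha,\beta)=\left|\frac{\alpha-\beta}{1-\overline{\beta}\alpha}\right|$ for $\alpha,\beta\in\mathbb{D}$. For a domain $\Omega\subset\mathbb{C}^d$ the Möbius pseudo-distance is $d_\Omega(z,w)=\sup\{d_{\mathbb{D}}(f(z),f(w)) : f:\Omega\to\mathbb{D}\text{ holomorphic}\}$. A commuting $d$-tuple $T=(T^1,\dots,T^d)$ of operators on $\mathbb{C}^2$ is diagonalizable if there are linearly independent $v_1,v_2\in\mathbb{C}^2$ and points $z_1,z_2\in\mathbb{C}^d$ (possibly equal), $z_j=(z_j^1,\dots,z_j^d)$,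 with $T^k v_j=z_j^k v_j$ for all $1\le k\le d$, $j=1,2$; its joint spectrum is $\sigma(T)=\{z_1,z_2\}$. For a matrix-valued function $G$ (of size $m\times n$) defined on $\sigma(T)$, $G(T)\in B(\mathbb{C}^n\otimes\mathbb{C}^2,\mathbb{C}^m\otimes\mathbb{C}^2)$ is the linear map with $G(T)(e\otimes v_j)=G(z_j)e\otimes v_j$ for $e\in\mathbb{C}^n$, $j=1,2$; this defines $\Delta(T)$ and $f(T)$. A domain $\Omega\subset\mathbb{C}^d$ is a complete spectral domain for $T$ if $\sigma(T)\subset\Omega$ and, for every positive integer $n$ and every holomorphic $n\times n$-matrix-valued function $f$ on $\Omega$, $\|f(T)\|\le\sup_{z\in\Omega}\|f(z)\|$. *)

theory Defs
  imports
    "HOL-Analysis.Analysis"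
    "HOL-Library.Extended_Real"
    "Jordan_Normal_Form.Schur_Decomposition"
begin

text \<open>Points of $d$-dimensional complex space have type \<open>complex ^ 'd\<close>, with $d$ the cardinality of
  \<open>'d\<close>. Matrices and operators are the carrier-based matrices of Jordan Normal Form, because the
  definition of a complete spectral domain quantifies over the matrix size.\<close>

no_notation vec_nth (infixl "$" 90)

definition holomorphic_several :: "(complex ^ 'd \<Rightarrow> complex) \<Rightarrow> (complex ^ 'd) set \<Rightarrow> bool" where
  "holomorphic_several f \<Omega> \<longleftrightarrow> open \<Omega> \<and>
     (\<forall>z\<in>\<Omega>. \<exists>D. (f has_derivative D) (at z) \<and> (\<forall>c h. D (c *s h) = c * D h))"

definition holomorphic_mat ::
    "nat \<Rightarrow> nat \<Rightarrow> (complex ^ 'd \<Rightarrow> complex mat) \<Rightarrow> (complex ^ 'd) set \<Rightarrow> bool" where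
  "holomorphic_mat m n F \<Omega> \<longleftrightarrow> (\<forall>z\<in>\<Omega>. F z \<in> carrier_mat m n) \<and>
     (\<forall>i<m. \<forall>j<n. holomorphic_several (\<lambda>z. F z $$ (i, j)) \<Omega>)"

definition is_domain :: "(complex ^ 'd) set \<Rightarrow> bool" where
  "is_domain \<Omega> \<longleftrightarrow> \<Omega> \<noteq> {} \<and> open \<Omega> \<and> connected \<Omega>"

definition vnorm :: "complex vec \<Rightarrow> real" where
  "vnorm x = L2_set (\<lambda>i. cmod (x $ i)) {..<dim_vec x}"

definition opnorm :: "complex mat \<Rightarrow> real" where
  "opnorm A = Sup {vnorm (A *\<^sub>v x) | x. x \<in> carrier_vec (dim_col A) \<and> vnorm x \<le> 1}"

definition positive_mat :: "complex mat \<Rightarrow> bool" where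
  "positive_mat A \<longleftrightarrow> dim_row A = dim_col A \<and> mat_adjoint A = A \<and>
     (\<forall>x \<in> carrier_vec (dim_col A). 0 \<le> Re ((A *\<^sub>v x) \<bullet>c x))"

definition mat_sqrt :: "complex mat \<Rightarrow> complex mat" where
  "mat_sqrt A = (THE S. positive_mat S \<and> S * S = A)"

definition mat_inv :: "complex mat \<Rightarrow> complex mat" where
  "mat_inv A = the (mat_inverse A)"

definition B_Delta :: "(complex ^ 'd) set \<Rightarrow> (complex ^ 'd \<Rightarrow> complex mat) \<Rightarrow> (complex ^ 'd) set" where
  "B_Delta E \<Delta> = {z \<in> E. opnorm (\<Delta> z) < 1}"

definition d_Delta :: "(complex ^ 'd \<Rightarrow> complex mat) \<Rightarrow> complex ^ 'd \<Rightarrow> complex ^ 'd \<Rightarrow> real" where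
  "d_Delta \<Delta> z w =
     (let Z = \<Delta> z; W = \<Delta> w; I\<^sub>s = 1\<^sub>m (dim_row W); I\<^sub>r = 1\<^sub>m (dim_col W) in
      opnorm (mat_inv (mat_sqrt (I\<^sub>s - W * mat_adjoint W)) * (Z - W)
              * mat_inv (I\<^sub>r - mat_adjoint W * Z) * mat_sqrt (I\<^sub>r - mat_adjoint W * W)))"

definition d_disk :: "complex \<Rightarrow> complex \<Rightarrow> real" where
  "d_disk \<alpha> \<beta> = cmod ((\<alpha> - \<beta>) / (1 - cnj \<beta> * \<alpha>))"

definition moebius_dist :: "(complex ^ 'd) set \<Rightarrow> complex ^ 'd \<Rightarrow> complex ^ 'd \<Rightarrow> real" where
  "moebius_dist \<Omega> z w =
     Sup {d_disk (f z) (f w) | f. holomorphic_several f \<Omega> \<and> f ` \<Omega> \<subseteq> ball 0 1}"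

definition commuting_tuple :: "('d \<Rightarrow> complex mat) \<Rightarrow> bool" where
  "commuting_tuple T \<longleftrightarrow> (\<forall>k. T k \<in> carrier_mat 2 2) \<and> (\<forall>k l. T k * T l = T l * T k)"

definition lin_indep2 :: "complex vec \<Rightarrow> complex vec \<Rightarrow> bool" where
  "lin_indep2 v1 v2 \<longleftrightarrow>
     (\<forall>a b. a \<cdot>\<^sub>v v1 + b \<cdot>\<^sub>v v2 = 0\<^sub>v 2 \<longrightarrow> a = 0 \<and> b = 0)"

definition diagonalizes ::
    "('d \<Rightarrow> complex mat) \<Rightarrow> complex vec \<Rightarrow> complex vec \<Rightarrow> complex ^ 'd \<Rightarrow> complex ^ 'd \<Rightarrow> bool" where
  "diagonalizes T v1 v2 z1 z2 \<longleftrightarrow>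
     v1 \<in> carrier_vec 2 \<and> v2 \<in> carrier_vec 2 \<and> lin_indep2 v1 v2 \<and>
     (\<forall>k. T k *\<^sub>v v1 = vec_nth z1 k \<cdot>\<^sub>v v1 \<and> T k *\<^sub>v v2 = vec_nth z2 k \<cdot>\<^sub>v v2)"

definition diagonalizable :: "('d::finite \<Rightarrow> complex mat) \<Rightarrow> bool" where
  "diagonalizable T \<longleftrightarrow> commuting_tuple T \<and> (\<exists>v1 v2 z1 z2. diagonalizes T v1 v2 z1 z2)"

text \<open>The set \<open>{z1, z2}\<close> does not depend on the choice of the diagonalization. Both this definition
  and the functional calculus below are meaningful for diagonalizable tuples only.\<close>

definition joint_spectrum :: "('d::finite \<Rightarrow> complex mat) \<Rightarrow> (complex ^ 'd) set" where
  "joint_spectrum T = (THE S. \<exists>v1 v2 z1 z2. diagonalizes T v1 v2 z1 z2 \<and> S = {z1, z2})"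

text \<open>The tensor product of spaces of dimensions $m$ and $n$ is identified with the space of
  dimension $mn$; the tensor of the basis vectors number $i$ and $j$ is the basis vector number
  $ni + j$. This identification is unitary.\<close>

definition tensor_vec :: "complex vec \<Rightarrow> complex vec \<Rightarrow> complex vec" (infixl "\<otimes>\<^sub>v" 70) where
  "e \<otimes>\<^sub>v v = vec (dim_vec e * dim_vec v) (\<lambda>i. e $ (i div dim_vec v) * v $ (i mod dim_vec v))"

text \<open>\<open>fun_calc m n G T\<close> is $G(T)$ for $G$ of size $m \times n$. The matrix determined by one
  diagonalization of \<open>T\<close> has the same property with respect to all others.\<close>

definition fun_calc ::
    "nat \<Rightarrow> nat \<Rightarrow> (complex ^ 'd \<Rightarrow> complex mat) \<Rightarrow> ('d \<Rightarrow> complex mat) \<Rightarrow> complex mat" where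
  "fun_calc m n G T = (THE A. A \<in> carrier_mat (m * 2) (n * 2) \<and>
     (\<forall>v1 v2 z1 z2. diagonalizes T v1 v2 z1 z2 \<longrightarrow>
        (\<forall>e \<in> carrier_vec n.
           A *\<^sub>v (e \<otimes>\<^sub>v v1) = (G z1 *\<^sub>v e) \<otimes>\<^sub>v v1 \<and>
           A *\<^sub>v (e \<otimes>\<^sub>v v2) = (G z2 *\<^sub>v e) \<otimes>\<^sub>v v2)))"

text \<open>The supremum is taken in the extended reals since \<open>f\<close> may be unbounded on \<open>\<Omega>\<close>.\<close>

definition complete_spectral_domain :: "(complex ^ 'd) set \<Rightarrow> ('d \<Rightarrow> complex mat) \<Rightarrow> bool" where
  "complete_spectral_domain \<Omega> T \<longleftrightarrow> is_domain \<Omega> \<and> joint_spectrum T \<subseteq> \<Omega> \<and>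
     (\<forall>n>0. \<forall>f. holomorphic_mat n n f \<Omega> \<longrightarrow>
        ereal (opnorm (fun_calc n n f T)) \<le> (SUP z\<in>\<Omega>. ereal (opnorm (f z))))"

end

(* Let Z = \<Delta>(z1), W = \<Delta>(z2), and let T have unit eigenvectors with scalar product c in [0, 1) for the
   joint eigenvalues z1, z2. Then \<parallel>\<Delta>(T)\<parallel> \<le> 1 says that the quadratic form
   |e1|^2 - |Z e1|^2 + |e2|^2 - |W e2|^2 + 2 c Re (<e1, e2> - <Z e1, W e2>) is nonnegative. Minimizing over
   e2 and using the identity for 1 - \<phi>* \<phi>, where \<phi> is the operator Moebius transform whose norm is
   d_\<Delta>(z1, z2), turns this into d_\<Delta>(z1, z2)^2 \<le> 1 - c^2. The same equivalence holds for every
   strictly contractive holomorphic matrix function f in place of \<Delta>. Moreover d_f is bounded by the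
   Moebius distance, since the scalar functions <\<phi> x, y> vanish at z2 and map the domain into the disk.
   If d_\<Delta> is the Moebius distance, then d_f \<le> d_\<Delta> and so \<parallel>\<Delta>(T)\<parallel> \<le> 1 implies \<parallel>f(T)\<parallel> \<le> 1.
   Conversely, letting c vary, applying the spectral property to scalar f bounds the Moebius distance
   by d_\<Delta>. *)

theory Submission
  imports Defs
begin

section \<open>Vectors and adjoints\<close>

text \<open>Apart from the two joint eigenvalues, a diagonalizable T is seen only through the number
  c, since a phase change of one eigenvector makes the scalar product real and nonnegative. Every c
  in [0, 1) occurs for every pair of points, so the tuples over a fixed pair probe the distance
  against all thresholds sqrt(1 - c^2). The threshold does not involve the size of the matrix
  function; this is why the bound for all matrix sizes follows from a distance defined by scalar
  functions. The inequality of d_\<Delta> with the Moebius distance holds on every such domain, so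
  the content of the equality is the reverse inequality. Two obstacles shape the development. Square
  roots, the joint spectrum and the functional calculus are definite descriptions, so existence and
  uniqueness come before any use of their values. And the Moebius transform is controlled for strict
  contractions only, while the norms of f may attain their supremum; f is therefore divided by a
  number strictly above that supremum.\<close>

lemma cscalar_prod_sum: "x \<bullet>c y = (\<Sum>i<dim_vec y. x $ i * cnj (y $ i))"
  by (simp add: scalar_prod_def atLeast0LessThan)

lemma cscalar_prod_add_left:
  fixes x y z :: "complex vec"
  assumes "x \<in> carrier_vec n" "y \<in> carrier_vec n" "z \<in> carrier_vec n"
  shows "(x + y) \<bullet>c z = x \<bullet>c z + y \<bullet>c z"
  using assms by (simp add: cscalar_prod_sum algebra_simps sum.distrib)

lemma cscalar_prod_add_right:
  fixes x y z :: "complex vec"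
  assumes "x \<in> carrier_vec n" "y \<in> carrier_vec n" "z \<in> carrier_vec n"
  shows "z \<bullet>c (x + y) = z \<bullet>c x + z \<bullet>c y"
  using assms by (simp add: cscalar_prod_sum algebra_simps sum.distrib)

lemma cscalar_prod_diff_left:
  fixes x y z :: "complex vec"
  assumes "x \<in> carrier_vec n" "y \<in> carrier_vec n" "z \<in> carrier_vec n"
  shows "(x - y) \<bullet>c z = x \<bullet>c z - y \<bullet>c z"
  using assms by (simp add: cscalar_prod_sum algebra_simps sum_subtractf)

lemma cscalar_prod_diff_right:
  fixes x y z :: "complex vec"
  assumes "x \<in> carrier_vec n" "y \<in> carrier_vec n" "z \<in> carrier_vec n"
  shows "z \<bullet>c (x - y) = z \<bullet>c x - z \<bullet>c y"
  using assms by (simp add: cscalar_prod_sum algebra_simps sum_subtractf)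

lemma cscalar_prod_smult_left:
  fixes x y :: "complex vec"
  assumes "x \<in> carrier_vec n" "y \<in> carrier_vec n"
  shows "(a \<cdot>\<^sub>v x) \<bullet>c y = a * (x \<bullet>c y)"
  using assms by (simp add: cscalar_prod_sum sum_distrib_left mult.assoc)

lemma cscalar_prod_smult_right:
  fixes x y :: "complex vec"
  assumes "x \<in> carrier_vec n" "y \<in> carrier_vec n"
  shows "x \<bullet>c (a \<cdot>\<^sub>v y) = cnj a * (x \<bullet>c y)"
  using assms by (simp add: cscalar_prod_sum sum_distrib_left mult_ac)

lemma cscalar_prod_commute:
  fixes x y :: "complex vec"
  assumes "x \<in> carrier_vec n" "y \<in> carrier_vec n"
  shows "y \<bullet>c x = cnj (x \<bullet>c y)"
  using assms by (simp add: cscalar_prod_sum mult_ac)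

lemma vnorm_nonneg [simp]: "0 \<le> vnorm x"
  by (simp add: vnorm_def L2_set_nonneg)

lemma cscalar_prod_self: "x \<bullet>c x = of_real ((vnorm x)\<^sup>2)"
  by (simp add: cscalar_prod_sum vnorm_def L2_set_def sum_nonneg flip: complex_norm_square)

lemma vnorm_power2: "(vnorm x)\<^sup>2 = Re (x \<bullet>c x)"
  by (simp add: cscalar_prod_self del: of_real_power)

lemma vnorm_zero_vec [simp]: "vnorm (0\<^sub>v n) = 0"
  by (simp add: vnorm_def L2_set_def)

lemma vnorm_eq_0_iff: "x \<in> carrier_vec n \<Longrightarrow> vnorm x = 0 \<longleftrightarrow> x = 0\<^sub>v n"
  using conjugate_square_eq_0_vec[of x n] by (simp add: cscalar_prod_self)

lemma vnorm_smult: "vnorm (a \<cdot>\<^sub>v x) = cmod a * vnorm x"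
  by (simp add: vnorm_def norm_mult L2_set_right_distrib cong: L2_set_cong_simp)

lemma vnorm_triangle:
  "x \<in> carrier_vec n \<Longrightarrow> y \<in> carrier_vec n \<Longrightarrow> vnorm (x + y) \<le> vnorm x + vnorm y"
  unfolding vnorm_def
  using order_trans[OF L2_set_mono L2_set_triangle_ineq,
      of "{..<n}" "\<lambda>i. cmod ((x + y) $ i)" "\<lambda>i. cmod (x $ i)" "\<lambda>i. cmod (y $ i)"]
  by (auto intro: norm_triangle_ineq)

lemma cscalar_prod_Cauchy_Schwarz:
  assumes "x \<in> carrier_vec n" "y \<in> carrier_vec n"
  shows "cmod (x \<bullet>c y) \<le> vnorm x * vnorm y"
proof -
  have "cmod (x \<bullet>c y) \<le> (\<Sum>i<n. cmod (x $ i) * cmod (y $ i))"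
    using assms by (auto simp: cscalar_prod_sum norm_mult intro!: norm_sum[THEN order_trans])
  also have "\<dots> \<le> L2_set (\<lambda>i. cmod (x $ i)) {..<n} * L2_set (\<lambda>i. cmod (y $ i)) {..<n}"
    using L2_set_mult_ineq[of "\<lambda>i. cmod (x $ i)" "\<lambda>i. cmod (y $ i)" "{..<n}"] by simp
  finally show ?thesis
    using assms by (simp add: vnorm_def)
qed

lemma vnorm_add_power2:
  assumes "x \<in> carrier_vec n" "y \<in> carrier_vec n"
  shows "(vnorm (x + y))\<^sup>2 = (vnorm x)\<^sup>2 + (vnorm y)\<^sup>2 + 2 * Re (x \<bullet>c y)"
proof -
  have "y \<bullet>c x = cnj (x \<bullet>c y)"
    using cscalar_prod_commute assms by blast
  then show ?thesis
    using assms by (simp add: vnorm_power2 cscalar_prod_add_left[of _ n] cscalar_prod_add_right[of _ n])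
qed

lemma unit_vec_vnorm [simp]: "i < n \<Longrightarrow> vnorm (unit_vec n i) = 1"
  by (simp add: vnorm_def L2_set_def unit_vec_def if_distrib[of "\<lambda>t. t\<^sup>2"] if_distrib[of cmod] cong: if_cong)

lemma vnorm_component_le: "i < dim_vec x \<Longrightarrow> cmod (x $ i) \<le> vnorm x"
  unfolding vnorm_def by (rule member_le_L2_set) auto

section \<open>Adjoints and matrix entries\<close>

lemma mat_adjoint_dim [simp]:
  "dim_row (mat_adjoint A) = dim_col A" "dim_col (mat_adjoint A) = dim_row A"
  by (simp_all add: mat_adjoint_def)

lemma mat_adjoint_carrier [simp]: "A \<in> carrier_mat m n \<Longrightarrow> mat_adjoint A \<in> carrier_mat n m"
  by (metis carrier_matD carrier_matI mat_adjoint_dim)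

lemma mat_adjoint_index [simp]:
  "i < dim_col A \<Longrightarrow> j < dim_row A \<Longrightarrow> mat_adjoint A $$ (i, j) = cnj (A $$ (j, i))"
  by (simp add: mat_adjoint_def mat_of_rows_def)

lemma mult_mat_vec_index:
  "A \<in> carrier_mat m n \<Longrightarrow> x \<in> carrier_vec n \<Longrightarrow> i < m \<Longrightarrow>
    (A *\<^sub>v x) $ i = (\<Sum>j<n. A $$ (i, j) * x $ j)"
  by (simp add: scalar_prod_def atLeast0LessThan)

lemma mult_mat_index:
  "A \<in> carrier_mat m k \<Longrightarrow> B \<in> carrier_mat k n \<Longrightarrow> i < m \<Longrightarrow> j < n \<Longrightarrow>
    (A * B) $$ (i, j) = (\<Sum>l<k. A $$ (i, l) * B $$ (l, j))"
  by (simp add: scalar_prod_def atLeast0LessThan)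

lemma cscalar_prod_adjoint:
  fixes A :: "complex mat"
  assumes "A \<in> carrier_mat m n" "x \<in> carrier_vec n" "y \<in> carrier_vec m"
  shows "(A *\<^sub>v x) \<bullet>c y = x \<bullet>c (mat_adjoint A *\<^sub>v y)"
proof -
  have "(A *\<^sub>v x) \<bullet>c y = (\<Sum>i<m. \<Sum>j<n. A $$ (i, j) * x $ j * cnj (y $ i))"
    using assms by (simp add: cscalar_prod_sum mult_mat_vec_index sum_distrib_right del: index_mult_mat_vec)
  also have "\<dots> = (\<Sum>j<n. \<Sum>i<m. A $$ (i, j) * x $ j * cnj (y $ i))"
    by (rule sum.swap)
  also have "\<dots> = x \<bullet>c (mat_adjoint A *\<^sub>v y)"
    using assms by (simp add: cscalar_prod_sum mult_mat_vec_index[of _ n m] sum_distrib_left mult_ac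
        del: index_mult_mat_vec)
  finally show ?thesis .
qed

lemma mat_adjoint_adjoint [simp]: "mat_adjoint (mat_adjoint A) = (A :: complex mat)"
  by (intro eq_matI) auto

lemma mat_adjoint_diff:
  fixes A B :: "complex mat"
  assumes "A \<in> carrier_mat m n" "B \<in> carrier_mat m n"
  shows "mat_adjoint (A - B) = mat_adjoint A - mat_adjoint B"
  using assms by (intro eq_matI) auto

lemma mat_adjoint_one [simp]: "mat_adjoint (1\<^sub>m n) = (1\<^sub>m n :: complex mat)"
  by (intro eq_matI) auto

lemma mat_adjoint_mult:
  fixes A B :: "complex mat"
  assumes "A \<in> carrier_mat m k" "B \<in> carrier_mat k n"
  shows "mat_adjoint (A * B) = mat_adjoint B * mat_adjoint A"
  using assms by (intro eq_matI) (auto simp: scalar_prod_def mult_ac)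

section \<open>The operator norm\<close>

text \<open>Testing on all vectors instead of the unit ball keeps norm estimates free of the
  supremum in \<open>opnorm\<close>; \<open>opnorm_le_iff\<close> translates between the
  two.\<close>

definition norm_bound :: "complex mat \<Rightarrow> real \<Rightarrow> bool" where
  "norm_bound A t \<longleftrightarrow> (\<forall>x \<in> carrier_vec (dim_col A). vnorm (A *\<^sub>v x) \<le> t * vnorm x)"

lemma norm_boundD:
  "norm_bound A t \<Longrightarrow> A \<in> carrier_mat m n \<Longrightarrow> x \<in> carrier_vec n \<Longrightarrow> vnorm (A *\<^sub>v x) \<le> t * vnorm x"
  by (auto simp: norm_bound_def)

lemma norm_boundI:
  "A \<in> carrier_mat m n \<Longrightarrow> (\<And>x. x \<in> carrier_vec n \<Longrightarrow> vnorm (A *\<^sub>v x) \<le> t * vnorm x) \<Longrightarrow> norm_bound A t"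
  by (auto simp: norm_bound_def)

text \<open>The sum of the moduli of all entries is a crude bound. It serves to make the supremum in
  \<open>opnorm\<close> one over a bounded set.\<close>

lemma norm_bound_exists: "\<exists>t\<ge>0. norm_bound A t"
proof -
  define t where "t = (\<Sum>i<dim_row A. \<Sum>j<dim_col A. cmod (A $$ (i, j)))"
  have "vnorm (A *\<^sub>v x) \<le> t * vnorm x" if x: "x \<in> carrier_vec (dim_col A)" for x
  proof -
    have "vnorm (A *\<^sub>v x) \<le> (\<Sum>i<dim_row A. cmod ((A *\<^sub>v x) $ i))"
      using L2_set_le_sum[of "{..<dim_row A}" "\<lambda>i. cmod ((A *\<^sub>v x) $ i)"] by (simp add: vnorm_def)
    also have "\<dots> \<le> (\<Sum>i<dim_row A. \<Sum>j<dim_col A. cmod (A $$ (i, j)) * vnorm x)"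
    proof (rule sum_mono)
      fix i assume i: "i \<in> {..<dim_row A}"
      have "cmod ((A *\<^sub>v x) $ i) = cmod (\<Sum>j<dim_col A. A $$ (i, j) * x $ j)"
        using i x mult_mat_vec_index[of A "dim_row A" "dim_col A" x i] by simp
      also have "\<dots> \<le> (\<Sum>j<dim_col A. cmod (A $$ (i, j) * x $ j))"
        by (rule norm_sum)
      also have "\<dots> \<le> (\<Sum>j<dim_col A. cmod (A $$ (i, j)) * vnorm x)"
        using x by (intro sum_mono) (auto simp: norm_mult intro!: mult_left_mono vnorm_component_le)
      finally show "cmod ((A *\<^sub>v x) $ i) \<le> (\<Sum>j<dim_col A. cmod (A $$ (i, j)) * vnorm x)" .
    qed
    finally show ?thesis
      by (simp add: t_def sum_distrib_right)
  qed
  moreover have "0 \<le> t"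
    by (auto simp: t_def intro!: sum_nonneg)
  ultimately show ?thesis
    by (auto simp: norm_bound_def)
qed

lemma opnorm_bdd_above: "bdd_above {vnorm (A *\<^sub>v x) | x. x \<in> carrier_vec (dim_col A) \<and> vnorm x \<le> 1}"
proof -
  obtain t where t: "0 \<le> t" "norm_bound A t"
    using norm_bound_exists by blast
  have "vnorm (A *\<^sub>v x) \<le> t" if "x \<in> carrier_vec (dim_col A)" "vnorm x \<le> 1" for x
  proof -
    have "vnorm (A *\<^sub>v x) \<le> t * vnorm x"
      using t(2) that by (auto simp: norm_bound_def)
    also have "\<dots> \<le> t * 1"
      using t that by (intro mult_left_mono) auto
    finally show ?thesis by simp
  qed
  then show ?thesis
    by (auto intro!: bdd_aboveI)
qed

lemma opnorm_upper:
  "x \<in> carrier_vec (dim_col A) \<Longrightarrow> vnorm x \<le> 1 \<Longrightarrow> vnorm (A *\<^sub>v x) \<le> opnorm A"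
  unfolding opnorm_def by (rule cSup_upper[OF _ opnorm_bdd_above]) auto

lemma opnorm_nonneg [simp]: "0 \<le> opnorm A"
  by (rule order_trans[OF vnorm_nonneg opnorm_upper[of "0\<^sub>v (dim_col A)"]]) auto

lemma norm_bound_opnorm: "norm_bound A (opnorm A)"
  unfolding norm_bound_def
proof
  fix x :: "complex vec" assume x: "x \<in> carrier_vec (dim_col A)"
  show "vnorm (A *\<^sub>v x) \<le> opnorm A * vnorm x"
  proof (cases "vnorm x = 0")
    case True
    then have "x = 0\<^sub>v (dim_col A)"
      using vnorm_eq_0_iff x by blast
    moreover have "A *\<^sub>v 0\<^sub>v (dim_col A) = 0\<^sub>v (dim_row A)"
      by (intro eq_vecI) auto
    ultimately show ?thesis
      by simp
  next
    case False
    define a where "a = complex_of_real (1 / vnorm x)"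
    have "vnorm (a \<cdot>\<^sub>v x) = 1"
      using False by (simp add: vnorm_smult a_def norm_divide)
    then have "vnorm (A *\<^sub>v (a \<cdot>\<^sub>v x)) \<le> opnorm A"
      using x by (intro opnorm_upper) auto
    moreover have "A *\<^sub>v (a \<cdot>\<^sub>v x) = a \<cdot>\<^sub>v (A *\<^sub>v x)"
      by (metis carrier_matI mult_mat_vec x)
    ultimately show ?thesis
      using False vnorm_nonneg[of x]
      by (simp add: vnorm_smult a_def norm_divide divide_le_eq less_le del: vnorm_nonneg)
  qed
qed

text \<open>The sign condition matters for matrices without columns: there \<open>norm_bound\<close>
  holds for every \<open>t\<close>, negative ones included, while the norm is 0.\<close>

lemma opnorm_le_iff: "0 \<le> t \<Longrightarrow> opnorm A \<le> t \<longleftrightarrow> norm_bound A t"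
proof
  assume "0 \<le> t" "opnorm A \<le> t"
  then show "norm_bound A t"
    using norm_bound_opnorm[of A] unfolding norm_bound_def
    by (meson mult_right_mono order_trans vnorm_nonneg)
next
  assume t: "0 \<le> t" and "norm_bound A t"
  then have *: "vnorm (A *\<^sub>v x) \<le> t" if "x \<in> carrier_vec (dim_col A)" "vnorm x \<le> 1" for x
    using that unfolding norm_bound_def by (meson mult_left_le order_trans)
  show "opnorm A \<le> t"
    unfolding opnorm_def
  proof (rule cSup_least)
    show "{vnorm (A *\<^sub>v x) |x. x \<in> carrier_vec (dim_col A) \<and> vnorm x \<le> 1} \<noteq> {}"
      by (auto intro!: exI[of _ "0\<^sub>v (dim_col A)"])
  qed (use * in auto)
qed

lemma vnorm_mult_le_opnorm:
  "A \<in> carrier_mat m n \<Longrightarrow> x \<in> carrier_vec n \<Longrightarrow> vnorm (A *\<^sub>v x) \<le> opnorm A * vnorm x"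
  using norm_boundD[OF norm_bound_opnorm] .

lemma opnorm_mult_le:
  assumes "A \<in> carrier_mat m k" "B \<in> carrier_mat k n"
  shows "opnorm (A * B) \<le> opnorm A * opnorm B"
proof -
  have "vnorm (A * B *\<^sub>v x) \<le> opnorm A * opnorm B * vnorm x" if x: "x \<in> carrier_vec n" for x
  proof -
    have "vnorm (A * B *\<^sub>v x) \<le> opnorm A * vnorm (B *\<^sub>v x)"
      using assms x by (simp add: assoc_mult_mat_vec[of _ m k _ n] vnorm_mult_le_opnorm[of _ m k])
    also have "\<dots> \<le> opnorm A * (opnorm B * vnorm x)"
      using assms x by (intro mult_left_mono vnorm_mult_le_opnorm) auto
    finally show ?thesis by (simp add: mult.assoc)
  qed
  then show ?thesis
    using assms by (subst opnorm_le_iff) (auto simp: norm_bound_def)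
qed

text \<open>For \<open>a = mat_adjoint A *\<^sub>v y\<close>, moving the adjoint to the other side
  and Cauchy-Schwarz give |a|^2 \<le> |A| |a| |y|, and one factor |a| cancels.\<close>

lemma opnorm_adjoint_le:
  assumes A: "A \<in> carrier_mat m n"
  shows "opnorm (mat_adjoint A) \<le> opnorm A"
proof -
  have "vnorm (mat_adjoint A *\<^sub>v y) \<le> opnorm A * vnorm y" if y: "y \<in> carrier_vec m" for y
  proof -
    let ?a = "mat_adjoint A *\<^sub>v y"
    have a: "?a \<in> carrier_vec n"
      using A y by (simp add: mult_mat_vec_carrier[of _ n m])
    have "(vnorm ?a)\<^sup>2 = Re ((A *\<^sub>v ?a) \<bullet>c y)"
      using A a y by (simp add: vnorm_power2 cscalar_prod_adjoint[of A m n])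
    also have "\<dots> \<le> cmod ((A *\<^sub>v ?a) \<bullet>c y)"
      by (rule complex_Re_le_cmod)
    also have "\<dots> \<le> vnorm (A *\<^sub>v ?a) * vnorm y"
      using A a y by (intro cscalar_prod_Cauchy_Schwarz) auto
    also have "\<dots> \<le> (opnorm A * vnorm ?a) * vnorm y"
      using A a by (intro mult_right_mono vnorm_mult_le_opnorm) auto
    finally have "vnorm ?a * vnorm ?a \<le> vnorm ?a * (opnorm A * vnorm y)"
      by (simp add: power2_eq_square mult_ac)
    then show ?thesis
      by (metis mult_le_cancel_left_pos mult_nonneg_nonneg opnorm_nonneg order.order_iff_strict
          vnorm_nonneg)
  qed
  then show ?thesis
    using A by (subst opnorm_le_iff) (auto simp: norm_bound_def)
qed

lemma opnorm_add_le:
  assumes "A \<in> carrier_mat m n" "B \<in> carrier_mat m n"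
  shows "opnorm (A + B) \<le> opnorm A + opnorm B"
proof -
  have "vnorm ((A + B) *\<^sub>v x) \<le> (opnorm A + opnorm B) * vnorm x" if x: "x \<in> carrier_vec n" for x
  proof -
    have "vnorm ((A + B) *\<^sub>v x) \<le> vnorm (A *\<^sub>v x) + vnorm (B *\<^sub>v x)"
      using assms x by (simp add: add_mult_distrib_mat_vec[of _ m n] vnorm_triangle[of _ m])
    also have "\<dots> \<le> opnorm A * vnorm x + opnorm B * vnorm x"
      using assms x by (intro add_mono vnorm_mult_le_opnorm)
    finally show ?thesis by (simp add: algebra_simps)
  qed
  then show ?thesis
    using assms by (subst opnorm_le_iff) (auto simp: norm_bound_def)
qed

lemma opnorm_smult:
  assumes "A \<in> carrier_mat m n"
  shows "opnorm (a \<cdot>\<^sub>m A) \<le> cmod a * opnorm A"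
proof -
  have "vnorm ((a \<cdot>\<^sub>m A) *\<^sub>v x) \<le> cmod a * opnorm A * vnorm x" if x: "x \<in> carrier_vec n" for x
  proof -
    have "(a \<cdot>\<^sub>m A) *\<^sub>v x = a \<cdot>\<^sub>v (A *\<^sub>v x)"
      using assms x by (intro eq_vecI) (auto simp: scalar_prod_def sum_distrib_left mult.assoc)
    then show ?thesis
      using vnorm_mult_le_opnorm[OF assms x] by (simp add: vnorm_smult mult_left_mono mult.assoc)
  qed
  then show ?thesis
    using assms by (subst opnorm_le_iff) (auto simp: norm_bound_def)
qed

lemma mat_index_unit_vec:
  fixes A :: "complex mat"
  assumes "A \<in> carrier_mat m n" "i < m" "j < n"
  shows "A $$ (i, j) = (A *\<^sub>v unit_vec n j) $ i"
  using assms mult_mat_vec_index[of A m n "unit_vec n j" i]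
  by (simp add: unit_vec_def if_distrib[of "\<lambda>t. _ * t"] cong: if_cong)

lemma mat_eqI_mult_vec:
  fixes A B :: "complex mat"
  assumes A: "A \<in> carrier_mat m n" and B: "B \<in> carrier_mat m n"
    and eq: "\<And>v. v \<in> carrier_vec n \<Longrightarrow> A *\<^sub>v v = B *\<^sub>v v"
  shows "A = B"
proof (rule eq_matI)
  fix i j assume "i < dim_row B" "j < dim_col B"
  then show "A $$ (i, j) = B $$ (i, j)"
    using A B eq[of "unit_vec n j"] by (auto simp: mat_index_unit_vec[of _ m n] simp del: index_mult_mat_vec)
qed (use A B in auto)

lemma cmod_entry_le_opnorm:
  assumes "A \<in> carrier_mat m n" "i < m" "j < n"
  shows "cmod (A $$ (i, j)) \<le> opnorm A"
proof -
  have "A $$ (i, j) = (A *\<^sub>v unit_vec n j) $ i"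
    using mat_index_unit_vec assms by blast
  also have "cmod \<dots> \<le> vnorm (A *\<^sub>v unit_vec n j)"
    using assms by (intro vnorm_component_le) auto
  also have "\<dots> \<le> opnorm A"
    using vnorm_mult_le_opnorm[of A m n "unit_vec n j"] assms by simp
  finally show ?thesis .
qed

section \<open>Inverses and square roots\<close>

text \<open>\<open>mat_inv\<close> unwraps an option, so it has a meaning only once
  \<open>mat_inverse A\<close> is known to be a \<open>Some\<close>. A trivial kernel yields this
  through the determinant, whose nonvanishing is kept as a conclusion for the holomorphy of
  inverses.\<close>

lemma mat_inv_injective:
  fixes A :: "complex mat"
  assumes A: "A \<in> carrier_mat n n"
    and inj: "\<And>v. v \<in> carrier_vec n \<Longrightarrow> A *\<^sub>v v = 0\<^sub>v n \<Longrightarrow> v = 0\<^sub>v n"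
  shows "mat_inv A \<in> carrier_mat n n" "A * mat_inv A = 1\<^sub>m n" "mat_inv A * A = 1\<^sub>m n"
    "det A \<noteq> 0"
proof -
  show det: "det A \<noteq> 0"
    using det_0_iff_vec_prod_zero_field[OF A] inj by blast
  from det_non_zero_imp_unit[OF A this] have "A \<in> Units (ring_mat TYPE(complex) n ())" .
  then obtain B where "mat_inverse A = Some B"
    using mat_inverse(1)[OF A, of "()"] by (cases "mat_inverse A") auto
  then show "mat_inv A \<in> carrier_mat n n" "A * mat_inv A = 1\<^sub>m n" "mat_inv A * A = 1\<^sub>m n"
    using mat_inverse(2)[OF A] by (auto simp: mat_inv_def)
qed

text \<open>A kernel vector is a fixed point of \<open>X\<close>, and a strict contraction fixes
  only 0.\<close>

lemma one_minus_injective: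
  assumes X: "X \<in> carrier_mat n n" and lt: "opnorm X < 1"
    and v: "v \<in> carrier_vec n" "(1\<^sub>m n - X) *\<^sub>v v = 0\<^sub>v n"
  shows "v = 0\<^sub>v n"
proof -
  have "v - X *\<^sub>v v = 0\<^sub>v n"
    using X v by (simp add: minus_mult_distrib_mat_vec[of _ n n])
  then have "v = X *\<^sub>v v"
    using X v by (auto simp: vec_eq_iff)
  then have "vnorm v \<le> opnorm X * vnorm v"
    using vnorm_mult_le_opnorm[OF X v(1)] by simp
  then have "vnorm v = 0"
    using lt by (metis mult_le_cancel_right1 not_less order.order_iff_strict vnorm_nonneg)
  then show ?thesis
    using vnorm_eq_0_iff v by blast
qed

section \<open>Entrywise limits and the square root iteration\<close>

definition mat_tendsto :: "nat \<Rightarrow> (nat \<Rightarrow> complex mat) \<Rightarrow> complex mat \<Rightarrow> bool" where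
  "mat_tendsto n A L \<longleftrightarrow> L \<in> carrier_mat n n \<and> (\<forall>k. A k \<in> carrier_mat n n) \<and>
     (\<forall>i<n. \<forall>j<n. (\<lambda>k. A k $$ (i, j)) \<longlonglongrightarrow> L $$ (i, j))"

lemma mat_tendsto_const: "A \<in> carrier_mat n n \<Longrightarrow> mat_tendsto n (\<lambda>_. A) A"
  by (simp add: mat_tendsto_def)

lemma mat_tendsto_mult:
  assumes "mat_tendsto n A K" "mat_tendsto n B L"
  shows "mat_tendsto n (\<lambda>k. A k * B k) (K * L)"
  using assms unfolding mat_tendsto_def
  by (auto simp: mult_mat_index[of _ n n _ n] simp del: index_mult_mat(1)
      intro!: tendsto_intros mult_carrier_mat[of _ n n])

lemma mat_tendsto_add:
  assumes "mat_tendsto n A K" "mat_tendsto n B L"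
  shows "mat_tendsto n (\<lambda>k. A k + B k) (K + L)"
  using assms unfolding mat_tendsto_def by (auto intro!: tendsto_intros simp: carrier_matD[of _ n n])

lemma mat_tendsto_smult:
  assumes "mat_tendsto n A K"
  shows "mat_tendsto n (\<lambda>k. a \<cdot>\<^sub>m A k) (a \<cdot>\<^sub>m K)"
  using assms unfolding mat_tendsto_def by (auto intro!: tendsto_intros simp: carrier_matD[of _ n n])

lemma mat_tendsto_adjoint:
  assumes "mat_tendsto n A K"
  shows "mat_tendsto n (\<lambda>k. mat_adjoint (A k)) (mat_adjoint K)"
  using assms unfolding mat_tendsto_def by (auto intro!: tendsto_intros simp: carrier_matD[of _ n n])

lemma mat_tendsto_unique:
  assumes "mat_tendsto n A K" "mat_tendsto n A L"
  shows "K = L"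
proof (rule eq_matI)
  fix i j assume "i < dim_row L" "j < dim_col L"
  then show "K $$ (i, j) = L $$ (i, j)"
    using assms by (auto simp: mat_tendsto_def intro!: LIMSEQ_unique[of "\<lambda>k. A k $$ (i, j)"])
qed (use assms in \<open>auto simp: mat_tendsto_def\<close>)

text \<open>For a fixed vector, the norm of its image depends continuously on the entries; the bound
  is tested vector by vector and so survives the limit.\<close>

lemma mat_tendsto_opnorm_le:
  assumes lim: "mat_tendsto n A K" and le: "\<And>k. opnorm (A k) \<le> t" and t: "0 \<le> t"
  shows "opnorm K \<le> t"
proof -
  have K: "K \<in> carrier_mat n n" and A: "\<And>k. A k \<in> carrier_mat n n"
    and entry: "\<And>i j. i < n \<Longrightarrow> j < n \<Longrightarrow> (\<lambda>k. A k $$ (i, j)) \<longlonglongrightarrow> K $$ (i, j)"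
    using lim by (auto simp: mat_tendsto_def)
  have "vnorm (K *\<^sub>v v) \<le> t * vnorm v" if v: "v \<in> carrier_vec n" for v
  proof (rule LIMSEQ_le_const2)
    have eq: "vnorm (B *\<^sub>v v) = sqrt (\<Sum>i<n. (cmod (\<Sum>j<n. B $$ (i, j) * v $ j))\<^sup>2)"
      if "B \<in> carrier_mat n n" for B
      using that v by (auto simp: vnorm_def L2_set_def mult_mat_vec_index[of _ n n]
          simp del: index_mult_mat_vec cong: sum.cong_simp)
    show "(\<lambda>k. vnorm (A k *\<^sub>v v)) \<longlonglongrightarrow> vnorm (K *\<^sub>v v)"
      unfolding eq[OF K] eq[OF A] by (auto intro!: tendsto_intros entry)
    show "\<exists>N. \<forall>k\<ge>N. vnorm (A k *\<^sub>v v) \<le> t * vnorm v"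
      using vnorm_mult_le_opnorm[OF A v] le by (meson mult_right_mono order_trans vnorm_nonneg)
  qed
  then show ?thesis
    using K t by (subst opnorm_le_iff) (auto simp: norm_bound_def)
qed

text \<open>If \<open>Y = (X + Y\<^sup>2) / 2\<close>, then \<open>1 - Y\<close> is a square root of \<open>1 - X\<close>. For \<open>\<parallel>X\<parallel> < 1\<close> this fixed
  point is the limit of the iteration.\<close>

primrec sqrt_iter :: "nat \<Rightarrow> complex mat \<Rightarrow> nat \<Rightarrow> complex mat" where
  "sqrt_iter n X 0 = 0\<^sub>m n n"
| "sqrt_iter n X (Suc k) = (1 / 2) \<cdot>\<^sub>m (X + sqrt_iter n X k * sqrt_iter n X k)"

lemma sqrt_iter_carrier: "X \<in> carrier_mat n n \<Longrightarrow> sqrt_iter n X k \<in> carrier_mat n n"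
  by (induction k) auto

text \<open>The iterates are polynomials in \<open>X\<close> with real coefficients, so they inherit
  self-adjointness from \<open>X\<close>.\<close>

lemma sqrt_iter_adjoint:
  assumes X: "X \<in> carrier_mat n n" "mat_adjoint X = X"
  shows "mat_adjoint (sqrt_iter n X k) = sqrt_iter n X k"
proof (induction k)
  case 0
  show ?case by (intro eq_matI) auto
next
  case (Suc k)
  note Y = sqrt_iter_carrier[OF X(1), of k]
  have "mat_adjoint ((1 / 2) \<cdot>\<^sub>m (A + B)) = (1 / 2) \<cdot>\<^sub>m (mat_adjoint A + mat_adjoint B)"
    if "A \<in> carrier_mat n n" "B \<in> carrier_mat n n" for A B :: "complex mat"
    using that by (intro eq_matI) auto
  then show ?case
    using X Y Suc mat_adjoint_mult[OF Y Y] by auto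
qed

text \<open>In the limit, the root commutes with everything that commutes with \<open>X\<close>. The
  uniqueness proof applies this to a competing root \<open>R\<close>.\<close>

lemma sqrt_iter_commute:
  assumes X: "X \<in> carrier_mat n n" and R: "R \<in> carrier_mat n n" "R * X = X * R"
  shows "R * sqrt_iter n X k = sqrt_iter n X k * R"
proof (induction k)
  case 0
  show ?case using R by simp
next
  case (Suc k)
  let ?Y = "sqrt_iter n X k"
  note Y = sqrt_iter_carrier[OF X(1), of k]
  have "R * (?Y * ?Y) = ?Y * ?Y * R"
    using Suc R X Y assoc_mult_mat[OF R(1) Y Y] assoc_mult_mat[OF Y R(1) Y] assoc_mult_mat[OF Y Y R(1)]
    by simp
  then have "R * (X + ?Y * ?Y) = (X + ?Y * ?Y) * R"
    using R X Y by (simp add: mult_add_distrib_mat[of R n n] add_mult_distrib_mat[of X n n])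
  then show ?case
    using R X Y by (simp add: mult_smult_distrib[of R n n _ n] mult_smult_assoc_mat[of _ n n _ n])
qed

lemma sqrt_iter_converges:
  assumes X: "X \<in> carrier_mat n n" and lt: "opnorm X < 1"
  shows "\<exists>Y q. mat_tendsto n (sqrt_iter n X) Y \<and> 0 \<le> q \<and> q < 1 \<and> opnorm Y \<le> q"
proof -
  \<comment> \<open>The smaller fixed point of the scalar iteration y -> (|X| + y^2) / 2, which
    dominates the norms of the matrix iterates.\<close>
  define q where "q = 1 - sqrt (1 - opnorm X)"
  have q: "0 \<le> q" "q < 1" "opnorm X + q\<^sup>2 = 2 * q"
    using lt by (auto simp: q_def power2_diff)
  let ?Y = "sqrt_iter n X"
  note Y = sqrt_iter_carrier[OF X]
  have Yq: "opnorm (?Y k) \<le> q" for k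
  proof (induction k)
    case 0
    have "0\<^sub>m n n *\<^sub>v v = 0\<^sub>v n" if "v \<in> carrier_vec n" for v :: "complex vec"
      using that by (intro eq_vecI) auto
    then show ?case
      using q by (subst opnorm_le_iff) (auto intro!: norm_boundI[of _ n n])
  next
    case (Suc k)
    have "opnorm (?Y (Suc k)) \<le> 1/2 * opnorm (X + ?Y k * ?Y k)"
      using opnorm_smult[OF add_carrier_mat[OF mult_carrier_mat[OF Y Y]], of "1/2" X k k]
      by (simp add: norm_divide)
    also have "opnorm (X + ?Y k * ?Y k) \<le> opnorm X + opnorm (?Y k * ?Y k)"
      using X mult_carrier_mat[OF Y Y] by (intro opnorm_add_le) auto
    also have "opnorm (?Y k * ?Y k) \<le> opnorm (?Y k) * opnorm (?Y k)"
      by (rule opnorm_mult_le[OF Y Y])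
    also have "\<dots> \<le> q * q"
      using Suc q by (intro mult_mono) auto
    finally show ?case
      using q by (simp add: power2_eq_square)
  qed
  have diff: "opnorm (?Y (Suc k) - ?Y k) \<le> q ^ Suc k" for k
  proof (induction k)
    case 0
    have "?Y (Suc 0) - ?Y 0 = ?Y (Suc 0)"
      using X by auto
    then show ?case
      using Yq[of "Suc 0"] by (simp del: sqrt_iter.simps)
  next
    case (Suc k)
    define P where "P = ?Y (Suc k)"
    define Q where "Q = ?Y k"
    have PQ: "P \<in> carrier_mat n n" "Q \<in> carrier_mat n n"
      using Y by (auto simp: P_def Q_def simp del: sqrt_iter.simps)
    have PQ': "P * (P - Q) \<in> carrier_mat n n" "(P - Q) * Q \<in> carrier_mat n n"
      using mult_carrier_mat[OF PQ(1) minus_carrier_mat[OF PQ(2)]]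
        mult_carrier_mat[OF minus_carrier_mat[OF PQ(2)] PQ(2)] .
    \<comment> \<open>This splitting of a difference of squares needs no commutation.
      \<open>P\<close> and \<open>Q\<close> have norm at most \<open>q\<close>, so with the factor
      1/2 of the iteration the steps shrink by the ratio (q + q) / 2 = q.\<close>
    have "P * (P - Q) + (P - Q) * Q = P * P - Q * Q"
      using PQ by (simp add: mult_minus_distrib_mat[of P n n] minus_mult_distrib_mat[of P n n])
         (intro eq_matI; auto)
    moreover have "?Y (Suc (Suc k)) - ?Y (Suc k) = (1 / 2) \<cdot>\<^sub>m (P * P - Q * Q)"
      using X PQ by (simp add: P_def[symmetric] Q_def[symmetric] del: sqrt_iter.simps(2))
        (simp add: P_def, intro eq_matI; auto simp: Q_def algebra_simps)
    ultimately have eq: "?Y (Suc (Suc k)) - ?Y (Suc k) = (1 / 2) \<cdot>\<^sub>m (P * (P - Q) + (P - Q) * Q)"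
      by simp
    have "opnorm (?Y (Suc (Suc k)) - ?Y (Suc k)) \<le> 1/2 * opnorm (P * (P - Q) + (P - Q) * Q)"
      unfolding eq using opnorm_smult[OF add_carrier_mat[OF PQ'(2)], of "1/2" "P * (P - Q)"]
      by (simp add: norm_divide)
    also have "opnorm (P * (P - Q) + (P - Q) * Q) \<le> opnorm (P * (P - Q)) + opnorm ((P - Q) * Q)"
      using PQ' by (rule opnorm_add_le)
    also have "opnorm (P * (P - Q)) \<le> opnorm P * opnorm (P - Q)"
      by (rule opnorm_mult_le[OF PQ(1) minus_carrier_mat[OF PQ(2)]])
    also have "\<dots> \<le> q * q ^ Suc k"
      using Yq[of "Suc k"] Suc q(1) unfolding P_def Q_def by (intro mult_mono) auto
    also have "opnorm ((P - Q) * Q) \<le> opnorm (P - Q) * opnorm Q"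
      by (rule opnorm_mult_le[OF minus_carrier_mat[OF PQ(2)] PQ(2)])
    also have "\<dots> \<le> q ^ Suc k * q"
      using Yq[of k] Suc q(1) unfolding P_def Q_def by (intro mult_mono) auto
    finally show ?case
      by simp
  qed
  have conv: "convergent (\<lambda>k. ?Y k $$ (i, j))" if ij: "i < n" "j < n" for i j
  proof -
    have bound: "cmod (?Y (Suc k) $$ (i, j) - ?Y k $$ (i, j)) \<le> q ^ Suc k" for k
    proof -
      have "?Y (Suc k) $$ (i, j) - ?Y k $$ (i, j) = (?Y (Suc k) - ?Y k) $$ (i, j)"
        using ij carrier_matD[OF Y] by (simp del: sqrt_iter.simps)
      also have "cmod \<dots> \<le> opnorm (?Y (Suc k) - ?Y k)"
        using Y ij by (intro cmod_entry_le_opnorm[of _ n n] minus_carrier_mat)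
      finally show ?thesis using diff[of k] by linarith
    qed
    have "summable (\<lambda>k. q ^ Suc k)"
      using q by (simp add: summable_geometric summable_mult)
    then have "summable (\<lambda>k. ?Y (Suc k) $$ (i, j) - ?Y k $$ (i, j))"
      by (rule summable_comparison_test'[where N = 0]) (rule bound)
    then have "convergent (\<lambda>k. \<Sum>l<k. ?Y (Suc l) $$ (i, j) - ?Y l $$ (i, j))"
      by (simp only: summable_iff_convergent)
    \<comment> \<open>The iteration starts at the zero matrix, so the telescoped sum leaves no
      initial term.\<close>
    moreover have "(\<Sum>l<k. ?Y (Suc l) $$ (i, j) - ?Y l $$ (i, j)) = ?Y k $$ (i, j)" for k
      using ij by (subst sum_lessThan_telescope) simp
    ultimately show ?thesis by simp
  qed
  define L where "L = mat n n (\<lambda>ij. lim (\<lambda>k. ?Y k $$ ij))"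
  have L: "mat_tendsto n ?Y L"
    using Y conv by (auto simp: mat_tendsto_def L_def convergent_LIMSEQ_iff)
  then show ?thesis
    using mat_tendsto_opnorm_le[OF L Yq q(1)] q by blast
qed

text \<open>The last two conclusions prepare uniqueness: the root is bounded below by some \<delta>
  > 0 (namely 1 - q, as \<open>Y\<close> has norm at most q), and it commutes with the commutant of
  \<open>X\<close>.\<close>

lemma positive_sqrt_exists:
  assumes X: "X \<in> carrier_mat n n" "mat_adjoint X = X" "opnorm X < 1"
  shows "\<exists>S \<delta>. S \<in> carrier_mat n n \<and> mat_adjoint S = S \<and> S * S = 1\<^sub>m n - X \<and> 0 < \<delta> \<and>
     (\<forall>v\<in>carrier_vec n. \<delta> * (vnorm v)\<^sup>2 \<le> Re ((S *\<^sub>v v) \<bullet>c v)) \<and>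
     (\<forall>R\<in>carrier_mat n n. R * X = X * R \<longrightarrow> R * S = S * R)"
proof -
  obtain Y q where lim: "mat_tendsto n (sqrt_iter n X) Y" and q: "0 \<le> q" "q < 1" "opnorm Y \<le> q"
    using sqrt_iter_converges[OF X(1,3)] by blast
  have Y: "Y \<in> carrier_mat n n"
    using lim by (simp add: mat_tendsto_def)
  define S where "S = 1\<^sub>m n - Y"
  have S: "S \<in> carrier_mat n n"
    using Y by (simp add: S_def minus_carrier_mat)
  have "mat_adjoint Y = Y"
    using mat_tendsto_unique[OF mat_tendsto_adjoint[OF lim]] lim
    by (simp add: sqrt_iter_adjoint[OF X(1,2)])
  then have adj: "mat_adjoint S = S"
    using Y by (simp add: S_def mat_adjoint_diff[of _ n n])
  have "mat_tendsto n (\<lambda>k. sqrt_iter n X (Suc k)) ((1 / 2) \<cdot>\<^sub>m (X + Y * Y))"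
    unfolding sqrt_iter.simps
    by (intro mat_tendsto_smult mat_tendsto_add mat_tendsto_mult mat_tendsto_const lim X)
  moreover have "mat_tendsto n (\<lambda>k. sqrt_iter n X (Suc k)) Y"
    using lim unfolding mat_tendsto_def by (auto simp del: sqrt_iter.simps intro: LIMSEQ_Suc)
  ultimately have fix_eq: "(1 / 2) \<cdot>\<^sub>m (X + Y * Y) = Y"
    using mat_tendsto_unique by blast
  have "Y $$ (i, j) = (X $$ (i, j) + (Y * Y) $$ (i, j)) / 2" if "i < n" "j < n" for i j
    using arg_cong[OF fix_eq, of "\<lambda>A. A $$ (i, j)"] that X Y by (simp del: index_mult_mat(1))
  then have entry: "(Y * Y) $$ (i, j) = 2 * Y $$ (i, j) - X $$ (i, j)" if "i < n" "j < n" for i j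
    using that by (simp add: field_simps del: index_mult_mat(1))
  have "S * S = (1\<^sub>m n - Y) - (Y - Y * Y)"
    using Y by (simp add: S_def mult_minus_distrib_mat[of _ n n _ n] minus_mult_distrib_mat[of _ n n _ _ n]
        minus_carrier_mat)
  also have "\<dots> = 1\<^sub>m n - X"
    using X Y by (intro eq_matI) (auto simp: entry simp del: index_mult_mat(1))
  finally have sq: "S * S = 1\<^sub>m n - X" .
  have pos: "(1 - q) * (vnorm v)\<^sup>2 \<le> Re ((S *\<^sub>v v) \<bullet>c v)" if v: "v \<in> carrier_vec n" for v
  proof -
    have "(S *\<^sub>v v) \<bullet>c v = v \<bullet>c v - (Y *\<^sub>v v) \<bullet>c v"
      using Y v by (simp add: S_def minus_mult_distrib_mat_vec[of _ n n] cscalar_prod_diff_left[of _ n])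
    moreover have "Re ((Y *\<^sub>v v) \<bullet>c v) \<le> q * vnorm v * vnorm v"
    proof -
      have "Re ((Y *\<^sub>v v) \<bullet>c v) \<le> cmod ((Y *\<^sub>v v) \<bullet>c v)"
        by (rule complex_Re_le_cmod)
      also have "\<dots> \<le> vnorm (Y *\<^sub>v v) * vnorm v"
        using Y v by (intro cscalar_prod_Cauchy_Schwarz) auto
      also have "\<dots> \<le> (opnorm Y * vnorm v) * vnorm v"
        using Y v by (intro mult_right_mono vnorm_mult_le_opnorm) auto
      also have "\<dots> \<le> q * vnorm v * vnorm v"
        using q by (intro mult_right_mono) auto
      finally show ?thesis .
    qed
    ultimately show ?thesis
      by (simp add: vnorm_power2[symmetric]) (simp add: algebra_simps power2_eq_square)
  qed
  have comm: "R * S = S * R" if R: "R \<in> carrier_mat n n" "R * X = X * R" for R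
  proof -
    have "mat_tendsto n (\<lambda>k. R * sqrt_iter n X k) (R * Y)" "mat_tendsto n (\<lambda>k. sqrt_iter n X k * R) (Y * R)"
      by (intro mat_tendsto_mult mat_tendsto_const lim R)+
    then have "R * Y = Y * R"
      using mat_tendsto_unique by (simp add: sqrt_iter_commute[OF X(1) R])
    then show ?thesis
      using R Y by (simp add: S_def mult_minus_distrib_mat[of _ n n _ n] minus_mult_distrib_mat[of _ n n _ _ n])
  qed
  show ?thesis
    using S adj sq pos comm q by (intro exI[of _ S] exI[of _ "1 - q"]) auto
qed

text \<open>Uniqueness: a positive root \<open>R\<close> commutes with its square, hence with
  \<open>X\<close>, hence with \<open>S\<close>. So (R + S)(R - S) = R^2 - S^2 = 0, and for w = (R -
  S) v the nonnegative numbers <R w, w> and <S w, w> add up to 0. The lower bound for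
  \<open>S\<close> then forces w = 0.\<close>

lemma mat_sqrt_one_minus:
  assumes X: "X \<in> carrier_mat n n" "mat_adjoint X = X" "opnorm X < 1"
  shows "mat_sqrt (1\<^sub>m n - X) \<in> carrier_mat n n"
    "mat_adjoint (mat_sqrt (1\<^sub>m n - X)) = mat_sqrt (1\<^sub>m n - X)"
    "mat_sqrt (1\<^sub>m n - X) * mat_sqrt (1\<^sub>m n - X) = 1\<^sub>m n - X"
proof -
  obtain S \<delta> where S: "S \<in> carrier_mat n n" "mat_adjoint S = S" "S * S = 1\<^sub>m n - X" and "0 < \<delta>"
    and pos: "\<And>v. v \<in> carrier_vec n \<Longrightarrow> \<delta> * (vnorm v)\<^sup>2 \<le> Re ((S *\<^sub>v v) \<bullet>c v)"
    and comm: "\<And>R. R \<in> carrier_mat n n \<Longrightarrow> R * X = X * R \<Longrightarrow> R * S = S * R"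
    using positive_sqrt_exists[OF X] by metis
  have "mat_sqrt (1\<^sub>m n - X) = S"
    unfolding mat_sqrt_def
  proof (rule the_equality)
    have "0 \<le> Re ((S *\<^sub>v v) \<bullet>c v)" if "v \<in> carrier_vec n" for v
      using pos[OF that] \<open>0 < \<delta>\<close> by (smt (verit) mult_nonneg_nonneg zero_le_power2)
    then show "positive_mat S \<and> S * S = 1\<^sub>m n - X"
      using S by (auto simp: positive_mat_def)
  next
    fix R assume R: "positive_mat R \<and> R * R = 1\<^sub>m n - X"
    \<comment> \<open>\<open>positive_mat\<close> leaves the size open; it is read off from the
      product.\<close>
    have "dim_row R = n"
      using R X by (metis carrier_matD(1) index_minus_mat(2) index_mult_mat(2))
    then have Rc: "R \<in> carrier_mat n n"
      using R by (auto simp: positive_mat_def)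
    have "R * (1\<^sub>m n - X) = (1\<^sub>m n - X) * R"
      using R Rc by (metis assoc_mult_mat)
    then have "R - R * X = R - X * R"
      using Rc X by (simp add: mult_minus_distrib_mat[of _ n n _ n] minus_mult_distrib_mat[of _ n n _ _ n])
    have "R * X = X * R"
    proof (rule eq_matI)
      fix i j assume "i < dim_row (X * R)" "j < dim_col (X * R)"
      then show "(R * X) $$ (i, j) = (X * R) $$ (i, j)"
        using arg_cong[OF \<open>R - R * X = R - X * R\<close>, of "\<lambda>A. A $$ (i, j)"] Rc X
        by (simp del: index_mult_mat(1))
    qed (use Rc X in auto)
    then have RS: "R * S = S * R"
      using comm Rc by blast
    have RSv: "R *\<^sub>v v = S *\<^sub>v v" if v: "v \<in> carrier_vec n" for v
    proof -
      define w where "w = R *\<^sub>v v - S *\<^sub>v v"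
      have w: "w \<in> carrier_vec n"
        using Rc S v by (simp add: w_def)
      have "R *\<^sub>v (R *\<^sub>v v) = S *\<^sub>v (S *\<^sub>v v)" "R *\<^sub>v (S *\<^sub>v v) = S *\<^sub>v (R *\<^sub>v v)"
        using R Rc S RS v by (metis assoc_mult_mat_vec)+
      then have "R *\<^sub>v w + S *\<^sub>v w = 0\<^sub>v n"
        using Rc S v by (simp add: w_def mult_minus_distrib_mat_vec[of _ n n])
           (intro eq_vecI; auto)
      then have "0 = (R *\<^sub>v w + S *\<^sub>v w) \<bullet>c w"
        using w by (simp add: scalar_prod_left_zero)
      also have "\<dots> = (R *\<^sub>v w) \<bullet>c w + (S *\<^sub>v w) \<bullet>c w"
        using w Rc S by (simp add: cscalar_prod_add_left[of _ n])
      finally have "Re ((R *\<^sub>v w) \<bullet>c w) + Re ((S *\<^sub>v w) \<bullet>c w) = 0"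
        by (metis plus_complex.sel(1) zero_complex.sel(1))
      moreover have "0 \<le> Re ((R *\<^sub>v w) \<bullet>c w)"
        using R Rc w by (auto simp: positive_mat_def)
      ultimately have "\<delta> * (vnorm w)\<^sup>2 \<le> 0"
        using pos[OF w] by linarith
      then have "vnorm w = 0"
        using \<open>0 < \<delta>\<close> by (simp add: mult_le_0_iff)
      then have "w = 0\<^sub>v n"
        using vnorm_eq_0_iff w by blast
      then show ?thesis
        using Rc S v unfolding w_def by (intro eq_vecI) (auto simp: vec_eq_iff)
    qed
    show "R = S"
      using mat_eqI_mult_vec[OF Rc S(1) RSv] .
  qed
  then show "mat_sqrt (1\<^sub>m n - X) \<in> carrier_mat n n"
    "mat_adjoint (mat_sqrt (1\<^sub>m n - X)) = mat_sqrt (1\<^sub>m n - X)"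
    "mat_sqrt (1\<^sub>m n - X) * mat_sqrt (1\<^sub>m n - X) = 1\<^sub>m n - X"
    using S by simp_all
qed

section \<open>Moebius transformations of matrix balls\<close>

text \<open>The value at \<open>Z\<close> of the automorphism of the open unit ball of matrices that
  sends \<open>W\<close> to 0.\<close>

definition moebius_mat :: "complex mat \<Rightarrow> complex mat \<Rightarrow> complex mat" where
  "moebius_mat Z W =
     mat_inv (mat_sqrt (1\<^sub>m (dim_row W) - W * mat_adjoint W)) * (Z - W)
       * mat_inv (1\<^sub>m (dim_col W) - mat_adjoint W * Z) * mat_sqrt (1\<^sub>m (dim_col W) - mat_adjoint W * W)"

lemma d_Delta_eq_opnorm: "d_Delta \<Delta> z w = opnorm (moebius_mat (\<Delta> z) (\<Delta> w))"
  by (simp add: d_Delta_def moebius_mat_def Let_def)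

lemma opnorm_adjoint_mult_less_1:
  assumes "A \<in> carrier_mat m n" "B \<in> carrier_mat m k" "opnorm A < 1" "opnorm B < 1"
  shows "opnorm (mat_adjoint A * B) < 1"
proof -
  have "opnorm (mat_adjoint A * B) \<le> opnorm (mat_adjoint A) * opnorm B"
    using assms by (intro opnorm_mult_le[of _ n m _ k]) auto
  also have "\<dots> \<le> opnorm A * opnorm B"
    using assms by (intro mult_right_mono opnorm_adjoint_le) auto
  also have "\<dots> < 1"
    using assms by (metis mult_strict_mono' mult_1 opnorm_nonneg)
  finally show ?thesis .
qed

lemma injective_if_square:
  fixes A :: "complex mat"
  assumes A: "A \<in> carrier_mat n n" and sq: "A * A = 1\<^sub>m n - X"
    and X: "X \<in> carrier_mat n n" "opnorm X < 1"
    and v: "v \<in> carrier_vec n" "A *\<^sub>v v = 0\<^sub>v n"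
  shows "v = 0\<^sub>v n"
proof -
  have "(A * A) *\<^sub>v v = A *\<^sub>v (A *\<^sub>v v)"
    using A v by (simp add: assoc_mult_mat_vec)
  also have "\<dots> = 0\<^sub>v n"
    using A v by (intro eq_vecI) auto
  finally show ?thesis
    using one_minus_injective[OF X v(1)] by (simp add: sq)
qed

text \<open>Strictness makes I - W* W, I - W W* and I - W* Z all of the form 1 - X with |X| < 1, so
  every root and inverse in the Moebius transform exists.\<close>

locale strict_contractions =
  fixes s r :: nat and Z W :: "complex mat"
  assumes Z: "Z \<in> carrier_mat s r" and W: "W \<in> carrier_mat s r"
    and norm_Z: "opnorm Z < 1" and norm_W: "opnorm W < 1"
begin

definition "R = mat_sqrt (1\<^sub>m r - mat_adjoint W * W)"
definition "S = mat_sqrt (1\<^sub>m s - W * mat_adjoint W)"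
definition "J = mat_inv (1\<^sub>m r - mat_adjoint W * Z)"
definition "Ri = mat_inv R"
definition "Si = mat_inv S"
text \<open>The substitution y = P x absorbs the inverse of I - W* Z: it turns \<phi> x into S^-1 (Z
  - W) y and R x into (I - W* Z) y.\<close>

definition "P = J * R"
abbreviation "\<phi> \<equiv> moebius_mat Z W"

lemma aW: "mat_adjoint W \<in> carrier_mat r s"
  using W by simp

lemma WW: "mat_adjoint W * W \<in> carrier_mat r r" "mat_adjoint (mat_adjoint W * W) = mat_adjoint W * W"
  "opnorm (mat_adjoint W * W) < 1"
  using W aW mat_adjoint_mult[OF aW W] opnorm_adjoint_mult_less_1[OF W W norm_W norm_W] by auto

lemma WW': "W * mat_adjoint W \<in> carrier_mat s s" "mat_adjoint (W * mat_adjoint W) = W * mat_adjoint W"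
  "opnorm (W * mat_adjoint W) < 1"
proof -
  have "opnorm (mat_adjoint W) < 1"
    using opnorm_adjoint_le[OF W] norm_W by linarith
  then show "opnorm (W * mat_adjoint W) < 1"
    using opnorm_adjoint_mult_less_1[OF aW aW] by simp
qed (use W aW mat_adjoint_mult[OF W aW] in auto)

lemma R: "R \<in> carrier_mat r r" "mat_adjoint R = R" "R * R = 1\<^sub>m r - mat_adjoint W * W"
  using mat_sqrt_one_minus[OF WW] by (auto simp: R_def)

lemma S: "S \<in> carrier_mat s s" "mat_adjoint S = S" "S * S = 1\<^sub>m s - W * mat_adjoint W"
  using mat_sqrt_one_minus[OF WW'] by (auto simp: S_def)

lemma R_injective: "v \<in> carrier_vec r \<Longrightarrow> R *\<^sub>v v = 0\<^sub>v r \<Longrightarrow> v = 0\<^sub>v r"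
  using injective_if_square[OF R(1,3) WW(1,3)] .

lemma Ri: "Ri \<in> carrier_mat r r" "R * Ri = 1\<^sub>m r" "Ri * R = 1\<^sub>m r"
  unfolding Ri_def using mat_inv_injective[OF R(1) R_injective] by auto

lemma S_injective: "v \<in> carrier_vec s \<Longrightarrow> S *\<^sub>v v = 0\<^sub>v s \<Longrightarrow> v = 0\<^sub>v s"
  using injective_if_square[OF S(1,3) WW'(1,3)] .

lemma Si: "Si \<in> carrier_mat s s" "S * Si = 1\<^sub>m s"
  unfolding Si_def using mat_inv_injective[OF S(1) S_injective] by auto

lemma WZ: "mat_adjoint W * Z \<in> carrier_mat r r" "opnorm (mat_adjoint W * Z) < 1"
  using Z aW opnorm_adjoint_mult_less_1[OF W Z norm_W norm_Z] by auto

lemma J: "J \<in> carrier_mat r r" "(1\<^sub>m r - mat_adjoint W * Z) * J = 1\<^sub>m r"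
   "J * (1\<^sub>m r - mat_adjoint W * Z) = 1\<^sub>m r" "det (1\<^sub>m r - mat_adjoint W * Z) \<noteq> 0"
  unfolding J_def using mat_inv_injective[OF minus_carrier_mat[OF WZ(1)] one_minus_injective[OF WZ]] by auto

lemma P: "P \<in> carrier_mat r r"
  using J R by (simp add: P_def)

lemma moebius_mat_eq: "\<phi> = Si * (Z - W) * J * R"
  using W by (simp add: moebius_mat_def Si_def S_def J_def R_def)

lemma moebius_mat_carrier: "\<phi> \<in> carrier_mat s r"
  unfolding moebius_mat_eq using Si J R W by (auto intro!: mult_carrier_mat minus_carrier_mat)

lemma assoc_vec:
  "A \<in> carrier_mat a b \<Longrightarrow> B \<in> carrier_mat b c \<Longrightarrow> v \<in> carrier_vec c \<Longrightarrow> A * B *\<^sub>v v = A *\<^sub>v (B *\<^sub>v (v :: complex vec))"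
  by (rule assoc_mult_mat_vec)

lemma one_minus_vec:
  "A \<in> carrier_mat a b \<Longrightarrow> B \<in> carrier_mat b a \<Longrightarrow> v \<in> carrier_vec a \<Longrightarrow>
    (1\<^sub>m a - A * B) *\<^sub>v v = v - A *\<^sub>v (B *\<^sub>v (v :: complex vec))"
  by (simp add: minus_mult_distrib_mat_vec[of _ a a] assoc_mult_mat_vec[of _ a b])

lemma P_eq:
  assumes x: "x \<in> carrier_vec r"
  shows "P *\<^sub>v x - mat_adjoint W *\<^sub>v (Z *\<^sub>v (P *\<^sub>v x)) = R *\<^sub>v x"
proof -
  have Rx: "R *\<^sub>v x \<in> carrier_vec r"
    using R x by auto
  have "P *\<^sub>v x - mat_adjoint W *\<^sub>v (Z *\<^sub>v (P *\<^sub>v x)) = (1\<^sub>m r - mat_adjoint W * Z) *\<^sub>v (P *\<^sub>v x)"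
    using one_minus_vec[OF aW Z] P x by auto
  also have "\<dots> = ((1\<^sub>m r - mat_adjoint W * Z) * J) *\<^sub>v (R *\<^sub>v x)"
    unfolding P_def using R x assoc_vec[OF J(1) R(1) x] assoc_vec[OF minus_carrier_mat[OF WZ(1)] J(1) Rx]
    by simp
  also have "\<dots> = R *\<^sub>v x"
    using Rx by (simp add: J)
  finally show ?thesis .
qed

text \<open>The inverse of \<open>P\<close> is R^-1 (I - W* Z). Hence every vector y has the form P
  x, and statements about x become statements about all y.\<close>

lemma P_Ri:
  assumes y: "y \<in> carrier_vec r"
  shows "P *\<^sub>v (Ri *\<^sub>v (y - mat_adjoint W *\<^sub>v (Z *\<^sub>v y))) = y"
proof -
  let ?u = "(1\<^sub>m r - mat_adjoint W * Z) *\<^sub>v y"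
  have u: "?u \<in> carrier_vec r"
    using mult_mat_vec_carrier[OF minus_carrier_mat[OF WZ(1)] y] .
  have "P *\<^sub>v (Ri *\<^sub>v ?u) = J *\<^sub>v ((R * Ri) *\<^sub>v ?u)"
    unfolding P_def using assoc_vec[OF J(1) R(1), of "Ri *\<^sub>v ?u"] assoc_vec[OF R(1) Ri(1) u] Ri u by simp
  also have "\<dots> = (J * (1\<^sub>m r - mat_adjoint W * Z)) *\<^sub>v y"
    using assoc_vec[OF J(1) minus_carrier_mat[OF WZ(1)] y] u by (simp add: Ri)
  also have "\<dots> = y"
    using y by (simp add: J)
  finally show ?thesis
    using one_minus_vec[OF aW Z y] by simp
qed

lemma moebius_mat_vec:
  assumes x: "x \<in> carrier_vec r"
  shows "S *\<^sub>v (\<phi> *\<^sub>v x) = Z *\<^sub>v (P *\<^sub>v x) - W *\<^sub>v (P *\<^sub>v x)"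
proof -
  have ZW: "Z - W \<in> carrier_mat s r"
    using W by (rule minus_carrier_mat)
  have y: "P *\<^sub>v x \<in> carrier_vec r"
    using P x by auto
  have "\<phi> = Si * ((Z - W) * P)"
    unfolding moebius_mat_eq P_def
    using assoc_mult_mat[OF mult_carrier_mat[OF Si(1) ZW] J(1) R(1)] assoc_mult_mat[OF Si(1) ZW P]
    by (simp add: P_def)
  then have "\<phi> *\<^sub>v x = Si *\<^sub>v ((Z - W) *\<^sub>v (P *\<^sub>v x))"
    using assoc_vec[OF Si(1) mult_carrier_mat[OF ZW P] x] assoc_vec[OF ZW P x] by simp
  then have "S *\<^sub>v (\<phi> *\<^sub>v x) = (S * Si) *\<^sub>v ((Z - W) *\<^sub>v (P *\<^sub>v x))"
    using assoc_vec[OF S(1) Si(1) mult_mat_vec_carrier[OF ZW y]] by simp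
  then show ?thesis
    using mult_mat_vec_carrier[OF ZW y] minus_mult_distrib_mat_vec[OF Z W y] by (simp add: Si)
qed

text \<open>With \<open>y = P x\<close> this is the identity
  \<open>1 - \<phi>\<^sup>* \<phi> = R (1 - Z\<^sup>* W)\<^sup>-\<^sup>1 (1 - Z\<^sup>* Z) (1 - W\<^sup>* Z)\<^sup>-\<^sup>1 R\<close>.\<close>

lemma moebius_mat_defect:
  assumes x: "x \<in> carrier_vec r"
  shows "(vnorm x)\<^sup>2 - (vnorm (\<phi> *\<^sub>v x))\<^sup>2 = (vnorm (P *\<^sub>v x))\<^sup>2 - (vnorm (Z *\<^sub>v (P *\<^sub>v x)))\<^sup>2"
proof -
  define y where "y = P *\<^sub>v x"
  define z where "z = Z *\<^sub>v y"
  define w where "w = W *\<^sub>v y"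
  define p where "p = \<phi> *\<^sub>v x"
  \<comment> \<open>The roots themselves are awkward, but S^2 = I - W W* is polynomial in W and W*.
    With \<open>l\<close>, which is S^-2 (z - w), and \<open>m\<close>, which is W* l, all
    computations involve S^2 and R^2 only.\<close>
  define l where "l = Si *\<^sub>v p"
  define m where "m = mat_adjoint W *\<^sub>v l"
  have car: "y \<in> carrier_vec r" "z \<in> carrier_vec s" "w \<in> carrier_vec s" "p \<in> carrier_vec s"
    "l \<in> carrier_vec s"
    using P x Z W Si moebius_mat_carrier by (auto simp: y_def z_def w_def p_def l_def)
  have m: "m \<in> carrier_vec r"
    unfolding m_def by (rule mult_mat_vec_carrier[OF aW car(5)])
  note car = car m
  have Sl: "S *\<^sub>v l = p"
    unfolding l_def using assoc_vec[OF S(1) Si(1) car(4)] Si car by simp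
  have v: "S *\<^sub>v p = z - w"
    using moebius_mat_vec[OF x] by (simp add: p_def y_def z_def w_def)
  have u: "R *\<^sub>v x = y - mat_adjoint W *\<^sub>v z"
    using P_eq[OF x] by (simp add: y_def z_def)
  have l: "l - W *\<^sub>v m = z - w"
    using one_minus_vec[OF W aW car(5)] assoc_vec[OF S(1) S(1) car(5)] by (simp add: S Sl v m_def)
  have Wv: "mat_adjoint W *\<^sub>v (l - W *\<^sub>v m) = m - mat_adjoint W *\<^sub>v (W *\<^sub>v m)"
    using mult_minus_distrib_mat_vec[OF aW car(5), of "W *\<^sub>v m"] W car by (simp add: m_def)
  have Wv': "mat_adjoint W *\<^sub>v (z - w) = mat_adjoint W *\<^sub>v z - mat_adjoint W *\<^sub>v w"
    using mult_minus_distrib_mat_vec[OF aW car(2,3)] .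
  \<comment> \<open>The aim is R (y - m) = x. Here R^2 y = y - W* w, and R^2 m = W* (l - W m) = W*
    (z - w); the difference is y - W* z = R x, and one factor R cancels by injectivity.\<close>
  have "R *\<^sub>v (R *\<^sub>v (y - m)) = (y - m) - mat_adjoint W *\<^sub>v (W *\<^sub>v (y - m))"
    using one_minus_vec[OF aW W, of "y - m"] assoc_vec[OF R(1) R(1), of "y - m"] car by (simp add: R)
  also have "\<dots> = (y - m) - (mat_adjoint W *\<^sub>v w - mat_adjoint W *\<^sub>v (W *\<^sub>v m))"
    using mult_minus_distrib_mat_vec[OF W car(1,6)] mult_minus_distrib_mat_vec[OF aW car(3), of "W *\<^sub>v m"]
      W car by (simp add: w_def)
  also have "\<dots> = y - mat_adjoint W *\<^sub>v w - (m - mat_adjoint W *\<^sub>v (W *\<^sub>v m))"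
    using car aW W by (intro eq_vecI) auto
  also have "m - mat_adjoint W *\<^sub>v (W *\<^sub>v m) = mat_adjoint W *\<^sub>v z - mat_adjoint W *\<^sub>v w"
    using Wv Wv' l by simp
  also have "y - mat_adjoint W *\<^sub>v w - (mat_adjoint W *\<^sub>v z - mat_adjoint W *\<^sub>v w) = R *\<^sub>v x"
    unfolding u using car aW W by (intro eq_vecI) auto
  finally have "R *\<^sub>v (R *\<^sub>v (y - m) - x) = 0\<^sub>v r"
    using mult_minus_distrib_mat_vec[OF R(1), of "R *\<^sub>v (y - m)" x] R x car by auto
  then have "R *\<^sub>v (y - m) - x = 0\<^sub>v r"
    using R_injective[of "R *\<^sub>v (y - m) - x"] R x car by auto
  then have k: "R *\<^sub>v (y - m) = x"
    using R x car by (auto simp: vec_eq_iff)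
  have car': "mat_adjoint W *\<^sub>v z \<in> carrier_vec r" "W *\<^sub>v m \<in> carrier_vec s"
    using mult_mat_vec_carrier[OF aW car(2)] mult_mat_vec_carrier[OF W car(6)] .
  have "x \<bullet>c x = x \<bullet>c (R *\<^sub>v (y - m))"
    by (simp add: k)
  also have "\<dots> = (R *\<^sub>v x) \<bullet>c (y - m)"
    using cscalar_prod_adjoint[OF R(1) x, of "y - m"] R car by simp
  also have "\<dots> = y \<bullet>c y - y \<bullet>c m - (mat_adjoint W *\<^sub>v z) \<bullet>c y + (mat_adjoint W *\<^sub>v z) \<bullet>c m"
    unfolding u using car car' by (simp add: cscalar_prod_diff_left[of _ r] cscalar_prod_diff_right[of _ r])
  also have "y \<bullet>c m = w \<bullet>c l"
    using cscalar_prod_adjoint[OF W car(1,5)] by (simp add: m_def w_def)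
  also have "(mat_adjoint W *\<^sub>v z) \<bullet>c y = z \<bullet>c w"
    using cscalar_prod_adjoint[OF aW car(2,1)] by (simp add: w_def)
  also have "(mat_adjoint W *\<^sub>v z) \<bullet>c m = z \<bullet>c (W *\<^sub>v m)"
    using cscalar_prod_adjoint[OF aW car(2,6)] by simp
  finally have xx: "x \<bullet>c x = y \<bullet>c y - w \<bullet>c l - z \<bullet>c w + z \<bullet>c (W *\<^sub>v m)" .
  have "p \<bullet>c p = (z - w) \<bullet>c l"
    using cscalar_prod_adjoint[OF S(1) car(4,5)] by (simp add: Sl S v)
  also have "\<dots> = z \<bullet>c l - w \<bullet>c l"
    using car by (simp add: cscalar_prod_diff_left[of _ s])
  finally have pp: "p \<bullet>c p = z \<bullet>c l - w \<bullet>c l" .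
  have "z \<bullet>c l - z \<bullet>c (W *\<^sub>v m) = z \<bullet>c (l - W *\<^sub>v m)"
    using car car' by (simp add: cscalar_prod_diff_right[of _ s])
  also have "\<dots> = z \<bullet>c z - z \<bullet>c w"
    unfolding l using car by (simp add: cscalar_prod_diff_right[of _ s])
  finally have zz: "z \<bullet>c z = z \<bullet>c l - z \<bullet>c (W *\<^sub>v m) + z \<bullet>c w"
    by (simp add: eq_diff_eq)
  have "x \<bullet>c x - p \<bullet>c p = y \<bullet>c y - z \<bullet>c z"
    unfolding xx pp zz by simp
  then show ?thesis
    unfolding vnorm_power2 y_def z_def p_def by (metis minus_complex.sel(1))
qed

text \<open>Contractivity of the map taking e1 \<otimes> v1 + e2 \<otimes> v2 to Z e1 \<otimes> v1 +
  W e2 \<otimes> v2, for unit vectors v1, v2 with scalar product c. Expanded in squared norms, it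
  involves v1 and v2 through c alone.\<close>

definition block_contractive :: "real \<Rightarrow> bool" where
  "block_contractive c \<longleftrightarrow> (\<forall>e1\<in>carrier_vec r. \<forall>e2\<in>carrier_vec r.
     (vnorm (Z *\<^sub>v e1))\<^sup>2 + (vnorm (W *\<^sub>v e2))\<^sup>2 + 2 * c * Re ((Z *\<^sub>v e1) \<bullet>c (W *\<^sub>v e2))
     \<le> (vnorm e1)\<^sup>2 + (vnorm e2)\<^sup>2 + 2 * c * Re (e1 \<bullet>c e2))"

text \<open>In the variables x and R e the form becomes simple. The part in e is |R e|^2 because R^2
  = I - W* W, and the mixed part is <(I - W* Z) P x, e> = <R x, e> = <x, R e>.\<close>

lemma block_defect:
  assumes x: "x \<in> carrier_vec r" and e: "e \<in> carrier_vec r"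
  defines "y \<equiv> P *\<^sub>v x"
  shows "(vnorm y)\<^sup>2 + (vnorm e)\<^sup>2 + 2 * c * Re (y \<bullet>c e)
      - ((vnorm (Z *\<^sub>v y))\<^sup>2 + (vnorm (W *\<^sub>v e))\<^sup>2 + 2 * c * Re ((Z *\<^sub>v y) \<bullet>c (W *\<^sub>v e)))
    = (vnorm x)\<^sup>2 - (vnorm (\<phi> *\<^sub>v x))\<^sup>2 + (vnorm (R *\<^sub>v e))\<^sup>2 + 2 * c * Re (x \<bullet>c (R *\<^sub>v e))"
proof -
  have y: "y \<in> carrier_vec r"
    using P x by (auto simp: y_def)
  have Zy: "Z *\<^sub>v y \<in> carrier_vec s" and WZy: "mat_adjoint W *\<^sub>v (Z *\<^sub>v y) \<in> carrier_vec r"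
    using Z aW y by auto
  have "x \<bullet>c (R *\<^sub>v e) = (R *\<^sub>v x) \<bullet>c e"
    using cscalar_prod_adjoint[OF R(1) x e] by (simp add: R)
  also have "\<dots> = y \<bullet>c e - (mat_adjoint W *\<^sub>v (Z *\<^sub>v y)) \<bullet>c e"
    using cscalar_prod_diff_left[OF y WZy e] P_eq[OF x] by (simp add: y_def)
  also have "(mat_adjoint W *\<^sub>v (Z *\<^sub>v y)) \<bullet>c e = (Z *\<^sub>v y) \<bullet>c (W *\<^sub>v e)"
    using cscalar_prod_adjoint[OF aW Zy e] by simp
  finally have 1: "Re (y \<bullet>c e) = Re (x \<bullet>c (R *\<^sub>v e)) + Re ((Z *\<^sub>v y) \<bullet>c (W *\<^sub>v e))"
    by simp
  have "(R *\<^sub>v e) \<bullet>c (R *\<^sub>v e) = e \<bullet>c (R *\<^sub>v (R *\<^sub>v e))"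
    using cscalar_prod_adjoint[OF R(1) e, of "R *\<^sub>v e"] R e by simp
  also have "\<dots> = e \<bullet>c e - e \<bullet>c (mat_adjoint W *\<^sub>v (W *\<^sub>v e))"
    using one_minus_vec[OF aW W e] assoc_vec[OF R(1) R(1) e]
      cscalar_prod_diff_right[OF e mult_mat_vec_carrier[OF aW mult_mat_vec_carrier[OF W e]] e]
    by (simp add: R)
  also have "e \<bullet>c (mat_adjoint W *\<^sub>v (W *\<^sub>v e)) = (W *\<^sub>v e) \<bullet>c (W *\<^sub>v e)"
    using cscalar_prod_adjoint[OF W e, of "W *\<^sub>v e"] W e by simp
  finally have "(vnorm (R *\<^sub>v e))\<^sup>2 = (vnorm e)\<^sup>2 - (vnorm (W *\<^sub>v e))\<^sup>2"
    unfolding vnorm_power2 by simp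
  then show ?thesis
    using moebius_mat_defect[OF x] unfolding 1 by (simp add: y_def distrib_left)
qed

lemma block_contractive_iff:
  assumes c: "0 \<le> c" "c \<le> 1"
  shows "block_contractive c \<longleftrightarrow> (opnorm \<phi>)\<^sup>2 \<le> 1 - c\<^sup>2"
proof
  assume le: "(opnorm \<phi>)\<^sup>2 \<le> 1 - c\<^sup>2"
  show "block_contractive c"
    unfolding block_contractive_def
  proof (intro ballI)
    fix y e :: "complex vec" assume y: "y \<in> carrier_vec r" and e: "e \<in> carrier_vec r"
    \<comment> \<open>The preimage of \<open>y\<close> under \<open>P\<close>, so that
      \<open>block_defect\<close> covers every pair.\<close>
    define x where "x = Ri *\<^sub>v (y - mat_adjoint W *\<^sub>v (Z *\<^sub>v y))"
    have x: "x \<in> carrier_vec r" and Px: "P *\<^sub>v x = y"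
      using P_Ri[OF y] y Ri Z aW by (auto simp: x_def)
    have "(vnorm (\<phi> *\<^sub>v x))\<^sup>2 \<le> (opnorm \<phi> * vnorm x)\<^sup>2"
      using vnorm_mult_le_opnorm[OF moebius_mat_carrier x] by (intro power_mono) auto
    also have "\<dots> \<le> (1 - c\<^sup>2) * (vnorm x)\<^sup>2"
      unfolding power_mult_distrib by (intro mult_right_mono le) auto
    finally have 1: "c\<^sup>2 * (vnorm x)\<^sup>2 \<le> (vnorm x)\<^sup>2 - (vnorm (\<phi> *\<^sub>v x))\<^sup>2"
      by (simp add: algebra_simps)
    have "\<bar>Re (x \<bullet>c (R *\<^sub>v e))\<bar> \<le> vnorm x * vnorm (R *\<^sub>v e)"
      using cscalar_prod_Cauchy_Schwarz[OF x, of "R *\<^sub>v e"] abs_Re_le_cmod[of "x \<bullet>c (R *\<^sub>v e)"] R e by auto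
    then have "c * Re (x \<bullet>c (R *\<^sub>v e)) \<ge> - (c * (vnorm x * vnorm (R *\<^sub>v e)))"
      using c mult_left_mono[of "- (vnorm x * vnorm (R *\<^sub>v e))" "Re (x \<bullet>c (R *\<^sub>v e))" c] by auto
    \<comment> \<open>After Cauchy-Schwarz the form is at least c^2 |x|^2 - 2 c |x| |R e| + |R e|^2,
      a complete square.\<close>
    moreover have "0 \<le> (c * vnorm x - vnorm (R *\<^sub>v e))\<^sup>2"
      by simp
    ultimately have "0 \<le> (vnorm x)\<^sup>2 - (vnorm (\<phi> *\<^sub>v x))\<^sup>2 + (vnorm (R *\<^sub>v e))\<^sup>2 + 2 * c * Re (x \<bullet>c (R *\<^sub>v e))"
      using 1 by (simp add: power2_diff power_mult_distrib)
    then show "(vnorm (Z *\<^sub>v y))\<^sup>2 + (vnorm (W *\<^sub>v e))\<^sup>2 + 2 * c * Re ((Z *\<^sub>v y) \<bullet>c (W *\<^sub>v e))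
        \<le> (vnorm y)\<^sup>2 + (vnorm e)\<^sup>2 + 2 * c * Re (y \<bullet>c e)"
      using block_defect[OF x e, of c] by (simp add: Px)
  qed
next
  assume block: "block_contractive c"
  have "vnorm (\<phi> *\<^sub>v x) \<le> sqrt (1 - c\<^sup>2) * vnorm x" if x: "x \<in> carrier_vec r" for x
  proof -
    \<comment> \<open>For fixed x, |u|^2 + 2 c Re <x, u> is minimal at u = -c x, with value -c^2
      |x|^2; \<open>Ri\<close> turns this u = R e back into e.\<close>
    let ?e = "of_real (- c) \<cdot>\<^sub>v (Ri *\<^sub>v x)"
    have e: "?e \<in> carrier_vec r"
      using Ri x by auto
    have "R *\<^sub>v (Ri *\<^sub>v x) = x"
      using assoc_vec[OF R(1) Ri(1) x] x Ri by simp
    then have Re: "R *\<^sub>v ?e = of_real (- c) \<cdot>\<^sub>v x"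
      using mult_mat_vec[OF R(1), of "Ri *\<^sub>v x"] Ri x by simp
    have "0 \<le> (vnorm x)\<^sup>2 - (vnorm (\<phi> *\<^sub>v x))\<^sup>2 + (vnorm (R *\<^sub>v ?e))\<^sup>2 + 2 * c * Re (x \<bullet>c (R *\<^sub>v ?e))"
      using block[unfolded block_contractive_def, rule_format, of "P *\<^sub>v x" ?e] block_defect[OF x e, of c] e P x
      by auto
    also have "vnorm (R *\<^sub>v ?e) = c * vnorm x"
      unfolding Re using c by (simp add: vnorm_smult)
    also have "Re (x \<bullet>c (R *\<^sub>v ?e)) = - c * (vnorm x)\<^sup>2"
      unfolding Re using x by (simp add: cscalar_prod_smult_right[of _ r] cscalar_prod_self flip: of_real_minus of_real_mult of_real_power)
    finally have "(vnorm (\<phi> *\<^sub>v x))\<^sup>2 \<le> (1 - c\<^sup>2) * (vnorm x)\<^sup>2"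
      by (simp add: algebra_simps power_mult_distrib power2_eq_square)
    then have "sqrt ((vnorm (\<phi> *\<^sub>v x))\<^sup>2) \<le> sqrt ((1 - c\<^sup>2) * (vnorm x)\<^sup>2)"
      by (rule real_sqrt_le_mono)
    then show ?thesis
      by (simp add: real_sqrt_mult)
  qed
  moreover have "c\<^sup>2 \<le> 1"
    using c by (simp add: abs_square_le_1)
  ultimately have "opnorm \<phi> \<le> sqrt (1 - c\<^sup>2)"
    using moebius_mat_carrier by (subst opnorm_le_iff) (auto simp: norm_bound_def)
  then have "(opnorm \<phi>)\<^sup>2 \<le> (sqrt (1 - c\<^sup>2))\<^sup>2"
    by (intro power_mono) auto
  then show "(opnorm \<phi>)\<^sup>2 \<le> 1 - c\<^sup>2"
    using \<open>c\<^sup>2 \<le> 1\<close> by simp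
qed

text \<open>By the defect identity the gap |x|^2 - |\<phi> x|^2 equals |y|^2 - |Z y|^2 for y = P x,
  and y is nonzero because R x is. The strict sign later keeps scalar competitors inside the open
  disk.\<close>

lemma moebius_mat_less:
  assumes x: "x \<in> carrier_vec r" "x \<noteq> 0\<^sub>v r"
  shows "vnorm (\<phi> *\<^sub>v x) < vnorm x"
proof -
  define y where "y = P *\<^sub>v x"
  have y: "y \<in> carrier_vec r"
    using P x by (auto simp: y_def)
  have "y \<noteq> 0\<^sub>v r"
  proof
    assume "y = 0\<^sub>v r"
    moreover have "Z *\<^sub>v 0\<^sub>v r = 0\<^sub>v s" "mat_adjoint W *\<^sub>v 0\<^sub>v s = 0\<^sub>v r"
      using Z W by (auto intro!: eq_vecI)
    ultimately have "R *\<^sub>v x = 0\<^sub>v r"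
      using P_eq[OF x(1)] by (simp add: y_def)
    then show False
      using R_injective x by blast
  qed
  then have "0 < vnorm y"
    using vnorm_eq_0_iff[OF y] by (simp add: less_le)
  then have "vnorm (Z *\<^sub>v y) < vnorm y"
    using vnorm_mult_le_opnorm[OF Z y] norm_Z by (smt (verit) mult_less_cancel_right2)
  then have "(vnorm (Z *\<^sub>v y))\<^sup>2 < (vnorm y)\<^sup>2"
    by (intro power_strict_mono) auto
  then have "(vnorm (\<phi> *\<^sub>v x))\<^sup>2 < (vnorm x)\<^sup>2"
    using moebius_mat_defect[OF x(1)] by (simp add: y_def)
  then show ?thesis
    by (rule power2_less_imp_less) simp
qed

end

lemma moebius_mat_self:
  assumes "W \<in> carrier_mat s r" "opnorm W < 1"
  shows "moebius_mat W W = 0\<^sub>m s r"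
proof -
  interpret strict_contractions s r W W
    using assms by unfold_locales
  have "W - W = 0\<^sub>m s r"
    using W by auto
  then show ?thesis
    unfolding moebius_mat_eq using Si J R by simp
qed

section \<open>Functional calculus of diagonalizable tuples\<close>

text \<open>In the numbering of the tensor product with a plane, the positions 2 a and 2 a + 1
  belong to index a of the first factor.\<close>

lemma sum_double: "(\<Sum>i<n * 2. f i) = (\<Sum>a<n. f (2 * a) + f (Suc (2 * a)) :: 'a :: comm_monoid_add)"
  by (induction n) (auto simp: add.assoc mult.commute)

lemma dim_tensor_vec [simp]: "dim_vec (e \<otimes>\<^sub>v v) = dim_vec e * dim_vec v"
  by (simp add: tensor_vec_def)

lemma tensor_vec_carrier: "e \<in> carrier_vec n \<Longrightarrow> v \<in> carrier_vec 2 \<Longrightarrow> e \<otimes>\<^sub>v v \<in> carrier_vec (n * 2)"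
  by (auto intro!: carrier_vecI)

lemma tensor_vec_index:
  "e \<in> carrier_vec n \<Longrightarrow> v \<in> carrier_vec 2 \<Longrightarrow> i < n * 2 \<Longrightarrow> (e \<otimes>\<^sub>v v) $ i = e $ (i div 2) * v $ (i mod 2)"
  by (auto simp: tensor_vec_def)

lemma tensor_vec_add_right:
  assumes "e \<in> carrier_vec n" "v \<in> carrier_vec 2" "w \<in> carrier_vec 2"
  shows "e \<otimes>\<^sub>v (v + w) = e \<otimes>\<^sub>v v + e \<otimes>\<^sub>v w"
  using assms
  by (intro eq_vecI) (auto simp: tensor_vec_def algebra_simps less_mult_imp_div_less)

lemma tensor_vec_smult_right:
  assumes "e \<in> carrier_vec n" "v \<in> carrier_vec 2"
  shows "e \<otimes>\<^sub>v (a \<cdot>\<^sub>v v) = a \<cdot>\<^sub>v (e \<otimes>\<^sub>v v)"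
  using assms
  by (intro eq_vecI) (auto simp: tensor_vec_def algebra_simps less_mult_imp_div_less)

lemma cscalar_prod_tensor:
  assumes "e \<in> carrier_vec n" "f \<in> carrier_vec n" "v \<in> carrier_vec 2" "w \<in> carrier_vec 2"
  shows "(e \<otimes>\<^sub>v v) \<bullet>c (f \<otimes>\<^sub>v w) = (e \<bullet>c f) * (v \<bullet>c w)"
proof -
  have "(e \<otimes>\<^sub>v v) \<bullet>c (f \<otimes>\<^sub>v w) = (\<Sum>i<n * 2. e $ (i div 2) * v $ (i mod 2) * cnj (f $ (i div 2) * w $ (i mod 2)))"
    using assms by (auto simp: cscalar_prod_sum tensor_vec_index intro!: sum.cong)
  also have "\<dots> = (\<Sum>a<n. (e $ a * cnj (f $ a)) * (v $ 0 * cnj (w $ 0) + v $ 1 * cnj (w $ 1)))"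
    unfolding sum_double by (intro sum.cong refl, simp, simp add: algebra_simps)
  also have "\<dots> = (e \<bullet>c f) * (v \<bullet>c w)"
    using assms by (simp add: cscalar_prod_sum sum_distrib_right numeral_2_eq_2)
  finally show ?thesis .
qed

lemma vnorm_tensor_power2:
  assumes "e \<in> carrier_vec n" "v \<in> carrier_vec 2"
  shows "(vnorm (e \<otimes>\<^sub>v v))\<^sup>2 = (vnorm e)\<^sup>2 * (vnorm v)\<^sup>2"
proof -
  have "complex_of_real ((vnorm (e \<otimes>\<^sub>v v))\<^sup>2) = of_real ((vnorm e)\<^sup>2 * (vnorm v)\<^sup>2)"
    using cscalar_prod_tensor[OF assms(1,1) assms(2,2)] unfolding cscalar_prod_self of_real_mult .
  then show ?thesis
    unfolding of_real_eq_iff .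
qed

section \<open>Bases of the plane and joint eigenvectors\<close>

lemma vec2_eqI:
  "v \<in> carrier_vec 2 \<Longrightarrow> w \<in> carrier_vec 2 \<Longrightarrow> v $ 0 = w $ 0 \<Longrightarrow> v $ 1 = w $ 1 \<Longrightarrow> v = w"
  by (intro eq_vecI) (auto simp: less_2_cases_iff)

lemma lin_indep2_det:
  assumes "lin_indep2 v1 v2" "v1 \<in> carrier_vec 2" "v2 \<in> carrier_vec 2"
  shows "v1 $ 0 * v2 $ 1 - v1 $ 1 * v2 $ 0 \<noteq> 0"
proof
  assume D: "v1 $ 0 * v2 $ 1 - v1 $ 1 * v2 $ 0 = 0"
  have dep: "a = 0 \<and> b = 0" if "a * v1 $ 0 + b * v2 $ 0 = 0" "a * v1 $ 1 + b * v2 $ 1 = 0" for a b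
  proof -
    have "a \<cdot>\<^sub>v v1 + b \<cdot>\<^sub>v v2 = 0\<^sub>v 2"
      using that assms by (intro vec2_eqI) auto
    then show ?thesis
      using assms(1) by (auto simp: lin_indep2_def)
  qed
  \<comment> \<open>If the determinant vanishes, the rows of the adjugate are coefficients of linear
    relations between v1 and v2. So all entries are 0, which leaves v1 + v2 = 0 as a nontrivial
    relation.\<close>
  have "v2 $ 1 = 0 \<and> - v1 $ 1 = 0" "v2 $ 0 = 0 \<and> - v1 $ 0 = 0"
    using D by (intro dep; simp add: algebra_simps)+
  then show False
    using dep[of 1 1] by simp
qed

locale diagonalized =
  fixes T :: "'d::finite \<Rightarrow> complex mat" and v1 v2 :: "complex vec" and z1 z2 :: "complex ^ 'd"
  assumes diag: "diagonalizes T v1 v2 z1 z2" and T: "\<And>k. T k \<in> carrier_mat 2 2"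
begin

lemma v1: "v1 \<in> carrier_vec 2" and v2: "v2 \<in> carrier_vec 2" and indep: "lin_indep2 v1 v2"
  and eigen: "T k *\<^sub>v v1 = vec_nth z1 k \<cdot>\<^sub>v v1" "T k *\<^sub>v v2 = vec_nth z2 k \<cdot>\<^sub>v v2"
  using diag by (auto simp: diagonalizes_def)

definition "D = v1 $ 0 * v2 $ 1 - v1 $ 1 * v2 $ 0"
text \<open>Cramer's rule: \<open>coord1 p q\<close> and \<open>coord2 p q\<close> are the
  coordinates of the vector (p, q) in the basis v1, v2.\<close>

definition "coord1 p q = (v2 $ 1 * p - v2 $ 0 * q) / D"
definition "coord2 p q = (v1 $ 0 * q - v1 $ 1 * p) / D"

lemma D: "D \<noteq> 0"
  unfolding D_def using lin_indep2_det[OF indep v1 v2] .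

lemma coords:
  "coord1 p q * v1 $ 0 + coord2 p q * v2 $ 0 = p" "coord1 p q * v1 $ 1 + coord2 p q * v2 $ 1 = q"
proof -
  have "coord1 p q * v1 $ 0 + coord2 p q * v2 $ 0 = p * D / D"
    "coord1 p q * v1 $ 1 + coord2 p q * v2 $ 1 = q * D / D"
    unfolding coord1_def coord2_def times_divide_eq_left add_divide_distrib[symmetric] D_def
    by (simp_all add: algebra_simps)
  then show "coord1 p q * v1 $ 0 + coord2 p q * v2 $ 0 = p" "coord1 p q * v1 $ 1 + coord2 p q * v2 $ 1 = q"
    using D by auto
qed

lemma coords_v: "coord1 (v1 $ 0) (v1 $ 1) = 1" "coord2 (v1 $ 0) (v1 $ 1) = 0"
  "coord1 (v2 $ 0) (v2 $ 1) = 0" "coord2 (v2 $ 0) (v2 $ 1) = 1"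
  using D by (auto simp: coord1_def coord2_def D_def algebra_simps)

lemma tensor_decomposition:
  assumes x: "x \<in> carrier_vec (n * 2)"
  shows "\<exists>e1\<in>carrier_vec n. \<exists>e2\<in>carrier_vec n. x = e1 \<otimes>\<^sub>v v1 + e2 \<otimes>\<^sub>v v2"
proof -
  define e1 where "e1 = vec n (\<lambda>a. coord1 (x $ (2 * a)) (x $ (2 * a + 1)))"
  define e2 where "e2 = vec n (\<lambda>a. coord2 (x $ (2 * a)) (x $ (2 * a + 1)))"
  have e: "e1 \<in> carrier_vec n" "e2 \<in> carrier_vec n"
    by (auto simp: e1_def e2_def)
  have "x = e1 \<otimes>\<^sub>v v1 + e2 \<otimes>\<^sub>v v2"
  proof (rule eq_vecI)
    fix i assume "i < dim_vec (e1 \<otimes>\<^sub>v v1 + e2 \<otimes>\<^sub>v v2)"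
    then have i: "i < n * 2"
      using e v1 v2 by auto
    then have a: "i div 2 < n"
      by (simp add: less_mult_imp_div_less)
    have "x $ i = (if i mod 2 = 0 then x $ (2 * (i div 2)) else x $ (2 * (i div 2) + 1))"
      by (metis add.right_neutral mult_div_mod_eq not_mod_2_eq_0_eq_1)
    also have "\<dots> = e1 $ (i div 2) * v1 $ (i mod 2) + e2 $ (i div 2) * v2 $ (i mod 2)"
      using a coords by (cases "i mod 2 = 0") (auto simp: e1_def e2_def)
    finally show "x $ i = (e1 \<otimes>\<^sub>v v1 + e2 \<otimes>\<^sub>v v2) $ i"
      using i e v1 v2 by (simp add: tensor_vec_index)
  qed (use x e v1 v2 in auto)
  with e show ?thesis by blast
qed

text \<open>Comparing coefficients in the basis v1, v2 kills each component whose eigenvalue differs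
  from z. The disjunctions also cover z1 = z2, where every vector is a joint eigenvector.
  Independence of the chosen diagonalization rests on this.\<close>

lemma eigenvector_cases:
  assumes v: "v \<in> carrier_vec 2" and ev: "\<And>k. T k *\<^sub>v v = vec_nth z k \<cdot>\<^sub>v v"
  shows "\<exists>\<alpha> \<beta>. v = \<alpha> \<cdot>\<^sub>v v1 + \<beta> \<cdot>\<^sub>v v2 \<and> (\<alpha> = 0 \<or> z = z1) \<and> (\<beta> = 0 \<or> z = z2)"
proof -
  define \<alpha> \<beta> where "\<alpha> = coord1 (v $ 0) (v $ 1)" and "\<beta> = coord2 (v $ 0) (v $ 1)"
  have eq: "v = \<alpha> \<cdot>\<^sub>v v1 + \<beta> \<cdot>\<^sub>v v2"
    using v v1 v2 coords by (intro vec2_eqI) (auto simp: \<alpha>_def \<beta>_def)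
  have "\<alpha> * (vec_nth z1 k - vec_nth z k) = 0 \<and> \<beta> * (vec_nth z2 k - vec_nth z k) = 0" for k
  proof -
    have "T k *\<^sub>v v = \<alpha> \<cdot>\<^sub>v (vec_nth z1 k \<cdot>\<^sub>v v1) + \<beta> \<cdot>\<^sub>v (vec_nth z2 k \<cdot>\<^sub>v v2)"
      unfolding eq using T v1 v2 by (simp add: mult_add_distrib_mat_vec[of _ 2 2] mult_mat_vec[of _ 2 2] eigen)
    then have "\<alpha> \<cdot>\<^sub>v (vec_nth z1 k \<cdot>\<^sub>v v1) + \<beta> \<cdot>\<^sub>v (vec_nth z2 k \<cdot>\<^sub>v v2) = vec_nth z k \<cdot>\<^sub>v (\<alpha> \<cdot>\<^sub>v v1 + \<beta> \<cdot>\<^sub>v v2)"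
      using ev[of k] eq by simp
    then have "(\<alpha> \<cdot>\<^sub>v (vec_nth z1 k \<cdot>\<^sub>v v1) + \<beta> \<cdot>\<^sub>v (vec_nth z2 k \<cdot>\<^sub>v v2)) $ i = (vec_nth z k \<cdot>\<^sub>v (\<alpha> \<cdot>\<^sub>v v1 + \<beta> \<cdot>\<^sub>v v2)) $ i" for i
      by simp
    from this[of 0] this[of 1]
    have "(\<alpha> * (vec_nth z1 k - vec_nth z k)) \<cdot>\<^sub>v v1 + (\<beta> * (vec_nth z2 k - vec_nth z k)) \<cdot>\<^sub>v v2 = 0\<^sub>v 2"
      using v1 v2 by (intro vec2_eqI) (auto simp: algebra_simps)
    then show ?thesis
      using indep unfolding lin_indep2_def by blast
  qed
  then have "\<alpha> = 0 \<or> z = z1" "\<beta> = 0 \<or> z = z2"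
    by (auto simp: Finite_Cartesian_Product.vec_eq_iff)
  with eq show ?thesis by blast
qed

lemma eigenvalue_in:
  assumes v: "v \<in> carrier_vec 2" "v \<noteq> 0\<^sub>v 2" and ev: "\<And>k. T k *\<^sub>v v = vec_nth z k \<cdot>\<^sub>v v"
  shows "z \<in> {z1, z2}"
proof -
  obtain \<alpha> \<beta> where "v = \<alpha> \<cdot>\<^sub>v v1 + \<beta> \<cdot>\<^sub>v v2" "\<alpha> = 0 \<or> z = z1" "\<beta> = 0 \<or> z = z2"
    using eigenvector_cases[OF v(1) ev] by blast
  moreover have "0 \<cdot>\<^sub>v v1 + 0 \<cdot>\<^sub>v v2 = 0\<^sub>v 2"
    using v1 v2 by (intro vec2_eqI) auto
  ultimately show ?thesis
    using v(2) by auto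
qed

lemma nonzero: "v1 \<noteq> 0\<^sub>v 2" "v2 \<noteq> 0\<^sub>v 2"
  using D by (auto simp: D_def)

end

lemma diagonalizes_imp_diagonalized:
  "diagonalizes T v1 v2 z1 z2 \<Longrightarrow> (\<And>k. T k \<in> carrier_mat 2 2) \<Longrightarrow> diagonalized T v1 v2 z1 z2"
  by (simp add: diagonalized_def)

context diagonalized
begin

lemma spectrum_unique:
  assumes "diagonalizes T v1' v2' z1' z2'"
  shows "{z1', z2'} = {z1, z2}"
proof -
  interpret other: diagonalized T v1' v2' z1' z2'
    using diagonalizes_imp_diagonalized[OF assms T] .
  have "z1' \<in> {z1, z2}" "z2' \<in> {z1, z2}"
    using eigenvalue_in other.v1 other.v2 other.nonzero other.eigen by blast+
  moreover have "z1 \<in> {z1', z2'}" "z2 \<in> {z1', z2'}"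
    using other.eigenvalue_in v1 v2 nonzero eigen by blast+
  ultimately show ?thesis by blast
qed

lemma joint_spectrum_eq: "joint_spectrum T = {z1, z2}"
  unfolding joint_spectrum_def
proof (rule the_equality)
  show "\<exists>v1 v2 z1' z2'. diagonalizes T v1 v2 z1' z2' \<and> {z1, z2} = {z1', z2'}"
    using diag by blast
qed (use spectrum_unique in blast)

text \<open>The matrix A \<otimes> E1 + B \<otimes> E2, with E1 and E2 the oblique projections onto
  the lines of v1 and v2 along each other. The conditional expressions are the coordinates of the
  two standard unit vectors of the plane.\<close>

definition calc_mat :: "nat \<Rightarrow> nat \<Rightarrow> complex mat \<Rightarrow> complex mat \<Rightarrow> complex mat" where
  "calc_mat m n A B = mat (m * 2) (n * 2) (\<lambda>(i, j).
     A $$ (i div 2, j div 2) * v1 $ (i mod 2) * (if j mod 2 = 0 then coord1 1 0 else coord1 0 1) +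
     B $$ (i div 2, j div 2) * v2 $ (i mod 2) * (if j mod 2 = 0 then coord2 1 0 else coord2 0 1))"

lemma calc_mat_tensor:
  assumes A: "A \<in> carrier_mat m n" and B: "B \<in> carrier_mat m n"
    and e: "e \<in> carrier_vec n" and v: "v \<in> carrier_vec 2"
  shows "calc_mat m n A B *\<^sub>v (e \<otimes>\<^sub>v v) =
    coord1 (v $ 0) (v $ 1) \<cdot>\<^sub>v ((A *\<^sub>v e) \<otimes>\<^sub>v v1) + coord2 (v $ 0) (v $ 1) \<cdot>\<^sub>v ((B *\<^sub>v e) \<otimes>\<^sub>v v2)"
proof (rule eq_vecI)
  have Ae: "A *\<^sub>v e \<in> carrier_vec m" "B *\<^sub>v e \<in> carrier_vec m"
    using A B e by auto
  have C: "calc_mat m n A B \<in> carrier_mat (m * 2) (n * 2)"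
    by (simp add: calc_mat_def)
  have lin: "coord1 p q = coord1 1 0 * p + coord1 0 1 * q" "coord2 p q = coord2 1 0 * p + coord2 0 1 * q" for p q
    by (simp_all add: coord1_def coord2_def diff_divide_distrib)
  fix i assume "i < dim_vec (coord1 (v $ 0) (v $ 1) \<cdot>\<^sub>v ((A *\<^sub>v e) \<otimes>\<^sub>v v1) + coord2 (v $ 0) (v $ 1) \<cdot>\<^sub>v ((B *\<^sub>v e) \<otimes>\<^sub>v v2))"
  then have i: "i < m * 2"
    using A B v2 by auto
  then have i2: "i div 2 < m"
    by (simp add: less_mult_imp_div_less)
  have "(calc_mat m n A B *\<^sub>v (e \<otimes>\<^sub>v v)) $ i = (\<Sum>j<n * 2. calc_mat m n A B $$ (i, j) * (e $ (j div 2) * v $ (j mod 2)))"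
    using i e v by (subst mult_mat_vec_index[OF C tensor_vec_carrier]) (auto simp: tensor_vec_index intro!: sum.cong)
  also have "\<dots> = (\<Sum>a<n. (A $$ (i div 2, a) * e $ a) * (coord1 (v $ 0) (v $ 1) * v1 $ (i mod 2)) +
      (B $$ (i div 2, a) * e $ a) * (coord2 (v $ 0) (v $ 1) * v2 $ (i mod 2)))"
    unfolding sum_double using i lin[of "v $ 0" "v $ 1"]
    by (intro sum.cong) (auto simp: calc_mat_def algebra_simps)
  also have "\<dots> = (A *\<^sub>v e) $ (i div 2) * (coord1 (v $ 0) (v $ 1) * v1 $ (i mod 2)) +
      (B *\<^sub>v e) $ (i div 2) * (coord2 (v $ 0) (v $ 1) * v2 $ (i mod 2))"
    using i2 A B e by (simp add: mult_mat_vec_index sum.distrib sum_distrib_right del: index_mult_mat_vec)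
  finally show "(calc_mat m n A B *\<^sub>v (e \<otimes>\<^sub>v v)) $ i =
    (coord1 (v $ 0) (v $ 1) \<cdot>\<^sub>v ((A *\<^sub>v e) \<otimes>\<^sub>v v1) + coord2 (v $ 0) (v $ 1) \<cdot>\<^sub>v ((B *\<^sub>v e) \<otimes>\<^sub>v v2)) $ i"
    using i v1 v2 A B Ae by (simp add: tensor_vec_index[of _ m] del: index_mult_mat_vec)
qed (use A B v1 v2 in \<open>auto simp: calc_mat_def\<close>)

text \<open>The description in \<open>fun_calc\<close> ranges over all diagonalizations, so the
  matrix built from one of them must be checked on every joint eigenvector. Uniqueness is easier:
  the tensors with v1 and v2 already span the space.\<close>

lemma fun_calc_property:
  assumes G: "G z1 \<in> carrier_mat m n" "G z2 \<in> carrier_mat m n"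
  shows "fun_calc m n G T \<in> carrier_mat (m * 2) (n * 2)"
    "\<And>e. e \<in> carrier_vec n \<Longrightarrow> fun_calc m n G T *\<^sub>v (e \<otimes>\<^sub>v v1) = (G z1 *\<^sub>v e) \<otimes>\<^sub>v v1"
    "\<And>e. e \<in> carrier_vec n \<Longrightarrow> fun_calc m n G T *\<^sub>v (e \<otimes>\<^sub>v v2) = (G z2 *\<^sub>v e) \<otimes>\<^sub>v v2"
proof -
  let ?prop = "\<lambda>A. A \<in> carrier_mat (m * 2) (n * 2) \<and>
     (\<forall>v1 v2 z1 z2. diagonalizes T v1 v2 z1 z2 \<longrightarrow> (\<forall>e \<in> carrier_vec n.
           A *\<^sub>v (e \<otimes>\<^sub>v v1) = (G z1 *\<^sub>v e) \<otimes>\<^sub>v v1 \<and> A *\<^sub>v (e \<otimes>\<^sub>v v2) = (G z2 *\<^sub>v e) \<otimes>\<^sub>v v2))"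
  define A where "A = calc_mat m n (G z1) (G z2)"
  have A: "A \<in> carrier_mat (m * 2) (n * 2)"
    by (simp add: A_def calc_mat_def)
  have tens: "(G z *\<^sub>v e) \<otimes>\<^sub>v v \<in> carrier_vec (m * 2)"
    if "z \<in> {z1, z2}" "e \<in> carrier_vec n" "v \<in> carrier_vec 2" for z e v
    using that G by (auto intro!: tensor_vec_carrier mult_mat_vec_carrier[of _ m n])
  have Av: "A *\<^sub>v (e \<otimes>\<^sub>v v1) = (G z1 *\<^sub>v e) \<otimes>\<^sub>v v1" "A *\<^sub>v (e \<otimes>\<^sub>v v2) = (G z2 *\<^sub>v e) \<otimes>\<^sub>v v2"
    if e: "e \<in> carrier_vec n" for e
  proof -
    have "1 \<cdot>\<^sub>v x + 0 \<cdot>\<^sub>v y = x" "0 \<cdot>\<^sub>v y + 1 \<cdot>\<^sub>v x = x"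
      if "x \<in> carrier_vec (m * 2)" "y \<in> carrier_vec (m * 2)" for x y :: "complex vec"
      using that by (auto intro!: eq_vecI)
    then show "A *\<^sub>v (e \<otimes>\<^sub>v v1) = (G z1 *\<^sub>v e) \<otimes>\<^sub>v v1" "A *\<^sub>v (e \<otimes>\<^sub>v v2) = (G z2 *\<^sub>v e) \<otimes>\<^sub>v v2"
      unfolding A_def calc_mat_tensor[OF G e v1, unfolded coords_v] calc_mat_tensor[OF G e v2, unfolded coords_v]
      using tens e v1 v2 by blast+
  qed
  have A_eigen: "A *\<^sub>v (e \<otimes>\<^sub>v v) = (G z *\<^sub>v e) \<otimes>\<^sub>v v"
    if e: "e \<in> carrier_vec n" and v: "v \<in> carrier_vec 2" "v \<noteq> 0\<^sub>v 2"
      and ev: "\<And>k. T k *\<^sub>v v = vec_nth z k \<cdot>\<^sub>v v" for e v z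
  proof -
    obtain \<alpha> \<beta> where ab: "v = \<alpha> \<cdot>\<^sub>v v1 + \<beta> \<cdot>\<^sub>v v2" "\<alpha> = 0 \<or> z = z1" "\<beta> = 0 \<or> z = z2"
      using eigenvector_cases[OF v(1) ev] by blast
    have z: "z \<in> {z1, z2}"
      using eigenvalue_in[OF v ev] .
    then have Gz: "G z *\<^sub>v e \<in> carrier_vec m"
      using G e by (auto intro!: mult_mat_vec_carrier)
    have split: "f \<otimes>\<^sub>v v = \<alpha> \<cdot>\<^sub>v (f \<otimes>\<^sub>v v1) + \<beta> \<cdot>\<^sub>v (f \<otimes>\<^sub>v v2)" if "f \<in> carrier_vec l" for f l
      unfolding ab(1) using that v1 v2 by (simp add: tensor_vec_add_right[of _ l] tensor_vec_smult_right[of _ l])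
    have zero: "0 \<cdot>\<^sub>v x = 0 \<cdot>\<^sub>v y"
      if "x \<in> carrier_vec (m * 2)" "y \<in> carrier_vec (m * 2)" for x y :: "complex vec"
      using that by (intro eq_vecI) auto
    have "A *\<^sub>v (e \<otimes>\<^sub>v v) = \<alpha> \<cdot>\<^sub>v (A *\<^sub>v (e \<otimes>\<^sub>v v1)) + \<beta> \<cdot>\<^sub>v (A *\<^sub>v (e \<otimes>\<^sub>v v2))"
      unfolding split[OF e] using A tensor_vec_carrier[OF e v1] tensor_vec_carrier[OF e v2]
      by (simp add: mult_add_distrib_mat_vec[of _ "m * 2" "n * 2"] mult_mat_vec[of _ "m * 2" "n * 2"])
    also have "\<dots> = \<alpha> \<cdot>\<^sub>v ((G z1 *\<^sub>v e) \<otimes>\<^sub>v v1) + \<beta> \<cdot>\<^sub>v ((G z2 *\<^sub>v e) \<otimes>\<^sub>v v2)"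
      by (simp add: Av e)
    \<comment> \<open>Either z1 = z, or the coefficient is 0 and the vector beside it may be
      exchanged freely.\<close>
    also have "\<alpha> \<cdot>\<^sub>v ((G z1 *\<^sub>v e) \<otimes>\<^sub>v v1) = \<alpha> \<cdot>\<^sub>v ((G z *\<^sub>v e) \<otimes>\<^sub>v v1)"
      using ab(2) zero[OF tens[OF _ e v1, of z1] tens[OF z e v1]] by (cases "\<alpha> = 0") simp_all
    also have "\<beta> \<cdot>\<^sub>v ((G z2 *\<^sub>v e) \<otimes>\<^sub>v v2) = \<beta> \<cdot>\<^sub>v ((G z *\<^sub>v e) \<otimes>\<^sub>v v2)"
      using ab(3) zero[OF tens[OF _ e v2, of z2] tens[OF z e v2]] by (cases "\<beta> = 0") simp_all
    also have "\<alpha> \<cdot>\<^sub>v ((G z *\<^sub>v e) \<otimes>\<^sub>v v1) + \<beta> \<cdot>\<^sub>v ((G z *\<^sub>v e) \<otimes>\<^sub>v v2) = (G z *\<^sub>v e) \<otimes>\<^sub>v v"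
      using split[OF Gz] by simp
    finally show ?thesis .
  qed
  have propA: "?prop A"
  proof (intro conjI allI impI ballI A)
    fix v1' v2' z1' z2' and e :: "complex vec"
    assume d: "diagonalizes T v1' v2' z1' z2'" and e: "e \<in> carrier_vec n"
    interpret other: diagonalized T v1' v2' z1' z2'
      using diagonalizes_imp_diagonalized[OF d T] .
    show "A *\<^sub>v (e \<otimes>\<^sub>v v1') = (G z1' *\<^sub>v e) \<otimes>\<^sub>v v1'" "A *\<^sub>v (e \<otimes>\<^sub>v v2') = (G z2' *\<^sub>v e) \<otimes>\<^sub>v v2'"
      using A_eigen e other.v1 other.v2 other.nonzero other.eigen by blast+
  qed
  have "fun_calc m n G T = A"
    unfolding fun_calc_def
  proof (rule the_equality)
    show "?prop A"
      by (rule propA)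
  next
    fix B assume hB: "?prop B"
    then have B: "B \<in> carrier_mat (m * 2) (n * 2)"
      by blast
    have Bv: "B *\<^sub>v (e \<otimes>\<^sub>v v1) = (G z1 *\<^sub>v e) \<otimes>\<^sub>v v1" "B *\<^sub>v (e \<otimes>\<^sub>v v2) = (G z2 *\<^sub>v e) \<otimes>\<^sub>v v2"
      if "e \<in> carrier_vec n" for e
      using hB diag that by blast+
    show "B = A"
    proof (rule mat_eqI_mult_vec[OF B A])
      fix x :: "complex vec" assume "x \<in> carrier_vec (n * 2)"
      then obtain e1 e2 where e: "e1 \<in> carrier_vec n" "e2 \<in> carrier_vec n" "x = e1 \<otimes>\<^sub>v v1 + e2 \<otimes>\<^sub>v v2"
        using tensor_decomposition by blast
      then show "B *\<^sub>v x = A *\<^sub>v x"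
        using A B tensor_vec_carrier v1 v2
        by (simp add: mult_add_distrib_mat_vec[of _ "m * 2" "n * 2"] Av Bv)
    qed
  qed
  then show "fun_calc m n G T \<in> carrier_mat (m * 2) (n * 2)"
    "\<And>e. e \<in> carrier_vec n \<Longrightarrow> fun_calc m n G T *\<^sub>v (e \<otimes>\<^sub>v v1) = (G z1 *\<^sub>v e) \<otimes>\<^sub>v v1"
    "\<And>e. e \<in> carrier_vec n \<Longrightarrow> fun_calc m n G T *\<^sub>v (e \<otimes>\<^sub>v v2) = (G z2 *\<^sub>v e) \<otimes>\<^sub>v v2"
    using A Av by auto
qed

text \<open>Every vector is e1 \<otimes> v1 + e2 \<otimes> v2, and the operator keeps this shape;
  unit length and the real scalar product make its squared norm the displayed quadratic form. A
  general \<open>t\<close> is allowed for the sake of rescaling.\<close>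

lemma opnorm_fun_calc_le_iff:
  assumes G: "G z1 \<in> carrier_mat m n" "G z2 \<in> carrier_mat m n" and t: "0 \<le> t"
    and unit: "vnorm v1 = 1" "vnorm v2 = 1" and c: "v1 \<bullet>c v2 = of_real c"
  shows "opnorm (fun_calc m n G T) \<le> t \<longleftrightarrow> (\<forall>e1\<in>carrier_vec n. \<forall>e2\<in>carrier_vec n.
     (vnorm (G z1 *\<^sub>v e1))\<^sup>2 + (vnorm (G z2 *\<^sub>v e2))\<^sup>2 + 2 * c * Re ((G z1 *\<^sub>v e1) \<bullet>c (G z2 *\<^sub>v e2))
     \<le> t\<^sup>2 * ((vnorm e1)\<^sup>2 + (vnorm e2)\<^sup>2 + 2 * c * Re (e1 \<bullet>c e2)))"
proof -
  let ?F = "fun_calc m n G T"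
  note F = fun_calc_property[OF G]
  have norm: "(vnorm (e1 \<otimes>\<^sub>v v1 + e2 \<otimes>\<^sub>v v2))\<^sup>2 = (vnorm e1)\<^sup>2 + (vnorm e2)\<^sup>2 + 2 * c * Re (e1 \<bullet>c e2)"
    if e: "e1 \<in> carrier_vec l" "e2 \<in> carrier_vec l" for e1 e2 l
  proof -
    have "(vnorm (e1 \<otimes>\<^sub>v v1))\<^sup>2 = (vnorm e1)\<^sup>2" "(vnorm (e2 \<otimes>\<^sub>v v2))\<^sup>2 = (vnorm e2)\<^sup>2"
      using e v1 v2 unit
      by (simp_all add: vnorm_tensor_power2[of _ l])
    then show ?thesis
      using e v1 v2 c
      by (simp add: vnorm_add_power2[OF tensor_vec_carrier tensor_vec_carrier, of _ l] cscalar_prod_tensor[of _ l])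
  qed
  have le_iff: "vnorm x \<le> t * vnorm y \<longleftrightarrow> (vnorm x)\<^sup>2 \<le> t\<^sup>2 * (vnorm y)\<^sup>2" for x y
    using t by (simp add: power_mult_distrib[symmetric] flip: abs_le_square_iff)
  have Fe: "?F *\<^sub>v (e1 \<otimes>\<^sub>v v1 + e2 \<otimes>\<^sub>v v2) = (G z1 *\<^sub>v e1) \<otimes>\<^sub>v v1 + (G z2 *\<^sub>v e2) \<otimes>\<^sub>v v2"
    if e: "e1 \<in> carrier_vec n" "e2 \<in> carrier_vec n" for e1 e2
    using mult_add_distrib_mat_vec[OF F(1) tensor_vec_carrier[OF e(1) v1] tensor_vec_carrier[OF e(2) v2]] F e
    by simp
  have Gc: "G z1 *\<^sub>v e \<in> carrier_vec m" "G z2 *\<^sub>v e \<in> carrier_vec m" if "e \<in> carrier_vec n" for e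
    using G that by auto
  have "opnorm ?F \<le> t \<longleftrightarrow> (\<forall>x\<in>carrier_vec (n * 2). vnorm (?F *\<^sub>v x) \<le> t * vnorm x)"
    using t F(1) by (simp add: opnorm_le_iff norm_bound_def)
  also have "\<dots> \<longleftrightarrow> (\<forall>e1\<in>carrier_vec n. \<forall>e2\<in>carrier_vec n.
      vnorm (?F *\<^sub>v (e1 \<otimes>\<^sub>v v1 + e2 \<otimes>\<^sub>v v2)) \<le> t * vnorm (e1 \<otimes>\<^sub>v v1 + e2 \<otimes>\<^sub>v v2))"
    using tensor_decomposition tensor_vec_carrier v1 v2 by (metis add_carrier_vec)
  finally show ?thesis
    by (simp add: le_iff Fe norm[OF Gc(1) Gc(2)] norm[of _ n])
qed

end

section \<open>The angle between joint eigenvectors\<close>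

lemma normalized_diagonalization:
  assumes "diagonalizable T"
  shows "\<exists>v1 v2 z1 z2 c. diagonalized T v1 v2 z1 z2 \<and> vnorm v1 = 1 \<and> vnorm v2 = 1 \<and>
    v1 \<bullet>c v2 = of_real c \<and> 0 \<le> c \<and> c < 1"
proof -
  obtain w1 w2 z1 z2 where d: "diagonalizes T w1 w2 z1 z2" and T: "\<And>k. T k \<in> carrier_mat 2 2"
    using assms by (auto simp: diagonalizable_def commuting_tuple_def)
  interpret w: diagonalized T w1 w2 z1 z2
    using diagonalizes_imp_diagonalized[OF d T] .
  note w.v1[simp] w.v2[simp]
  have n: "vnorm w1 \<noteq> 0" "vnorm w2 \<noteq> 0"
    using w.nonzero vnorm_eq_0_iff[of _ 2] by auto
  define g where "g = w1 \<bullet>c w2"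
  \<comment> \<open>The phase of g, removed from the scalar product below; the value 1 for g = 0
    keeps \<open>u\<close> unimodular.\<close>
  define u where "u = (if g = 0 then 1 else g / of_real (cmod g))"
  have u: "cmod u = 1" "cnj u * g = of_real (cmod g)"
    using complex_norm_square[of g]
    by (auto simp: u_def norm_divide divide_eq_eq power2_eq_square mult.commute)
  define a b where "a = complex_of_real (1 / vnorm w1)" and "b = u * of_real (1 / vnorm w2)"
  have ab: "a \<noteq> 0" "b \<noteq> 0"
    using n u by (auto simp: a_def b_def)
  define c where "c = cmod g / (vnorm w1 * vnorm w2)"
  define v1 v2 where "v1 = a \<cdot>\<^sub>v w1" and "v2 = b \<cdot>\<^sub>v w2"
  have v: "v1 \<in> carrier_vec 2" "v2 \<in> carrier_vec 2"
    by (auto simp: v1_def v2_def)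
  have unit: "vnorm v1 = 1" "vnorm v2 = 1"
    using n u by (auto simp: v1_def v2_def a_def b_def vnorm_smult norm_mult norm_divide)
  have "v1 \<bullet>c v2 = a * (cnj b * g)"
    by (simp add: v1_def v2_def g_def cscalar_prod_smult_left[of _ 2] cscalar_prod_smult_right[of _ 2])
  also have "\<dots> = (cnj u * g) * of_real (1 / (vnorm w1 * vnorm w2))"
    by (simp add: a_def b_def)
  also have "\<dots> = of_real c"
    unfolding u by (simp add: c_def)
  finally have vv: "v1 \<bullet>c v2 = of_real c" .
  have "lin_indep2 v1 v2"
    unfolding lin_indep2_def
  proof (intro allI impI)
    fix p q assume "p \<cdot>\<^sub>v v1 + q \<cdot>\<^sub>v v2 = 0\<^sub>v 2"
    then have "(p * a) \<cdot>\<^sub>v w1 + (q * b) \<cdot>\<^sub>v w2 = 0\<^sub>v 2"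
      by (simp add: v1_def v2_def smult_smult_assoc)
    then have "p * a = 0 \<and> q * b = 0"
      using w.indep unfolding lin_indep2_def by blast
    then show "p = 0 \<and> q = 0"
      using ab by auto
  qed
  moreover have "T k *\<^sub>v v1 = vec_nth z1 k \<cdot>\<^sub>v v1" "T k *\<^sub>v v2 = vec_nth z2 k \<cdot>\<^sub>v v2" for k
    unfolding v1_def v2_def using T by (simp_all add: mult_mat_vec[of _ 2 2] w.eigen smult_smult_assoc mult.commute)
  ultimately have "diagonalizes T v1 v2 z1 z2"
    using v by (simp add: diagonalizes_def)
  then interpret v: diagonalized T v1 v2 z1 z2
    using T by unfold_locales
  \<comment> \<open>Independence gives the strict bound on c, since |v1 - v2|^2 = 2 - 2 c.\<close>
  have "v1 + (-1) \<cdot>\<^sub>v v2 \<noteq> 0\<^sub>v 2"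
    using v.indep[unfolded lin_indep2_def, rule_format, of 1 "-1"] by auto
  then have "vnorm (v1 + (-1) \<cdot>\<^sub>v v2) \<noteq> 0"
    using v vnorm_eq_0_iff[of "v1 + (-1) \<cdot>\<^sub>v v2" 2] by simp
  then have "0 < (vnorm (v1 + (-1) \<cdot>\<^sub>v v2))\<^sup>2"
    by simp
  also have "\<dots> = 2 - 2 * c"
    using v unit vv by (simp add: vnorm_add_power2[of _ 2] vnorm_smult cscalar_prod_smult_right[of _ 2])
  finally have "c < 1"
    by simp
  moreover have "0 \<le> c"
    by (simp add: c_def)
  ultimately show ?thesis
    using v.diagonalized_axioms unit vv by blast
qed

lemma diagonalizable_with_angle:
  fixes z w :: "complex ^ 'd"
  assumes c: "0 \<le> c" "c < 1"
  shows "\<exists>T v1 v2. diagonalizable T \<and> diagonalized T v1 v2 z w \<and> vnorm v1 = 1 \<and> vnorm v2 = 1 \<and>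
    v1 \<bullet>c v2 = complex_of_real c"
proof -
  define q where "q = sqrt (1 - c\<^sup>2)"
  have "c\<^sup>2 < 1"
    using c by (simp add: power_less_one_iff abs_square_less_1)
  then have q: "0 < q" "q\<^sup>2 = 1 - c\<^sup>2"
    by (auto simp: q_def)
  define v1 where "v1 = vec 2 (\<lambda>i. if i = 0 then 1 else 0 :: complex)"
  define v2 where "v2 = vec 2 (\<lambda>i. complex_of_real (if i = 0 then c else q))"
  \<comment> \<open>In the basis making v1 = (1, 0) and v2 = (c, q), each operator is upper
    triangular, and the eigenvalue equation at v2 forces the corner entry c (w - z) / q. Here c < 1
    ensures q > 0.\<close>
  define T where "T k = mat 2 2 (\<lambda>(i, j). if i = 0 \<and> j = 0 then vec_nth z k else if i = 0 then
     of_real (c / q) * (vec_nth w k - vec_nth z k) else if j = 0 then 0 else vec_nth w k)" for k :: 'd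
  have carrier [simp]: "v1 \<in> carrier_vec 2" "v2 \<in> carrier_vec 2" "T k \<in> carrier_mat 2 2" for k
    by (auto simp: v1_def v2_def T_def)
  have T_index: "(T k *\<^sub>v v) $ 0 = vec_nth z k * v $ 0 + of_real (c / q) * (vec_nth w k - vec_nth z k) * v $ 1"
    "(T k *\<^sub>v v) $ 1 = vec_nth w k * v $ 1" if "v \<in> carrier_vec 2" for k v
    using that by (subst mult_mat_vec_index[of _ 2 2]; simp add: T_def numeral_2_eq_2)+
  have v_index: "v1 $ 0 = 1" "v1 $ 1 = 0" "v2 $ 0 = of_real c" "v2 $ 1 = of_real q"
    by (auto simp: v1_def v2_def)
  have indep: "lin_indep2 v1 v2"
    unfolding lin_indep2_def
  proof (intro allI impI)
    fix a b assume "a \<cdot>\<^sub>v v1 + b \<cdot>\<^sub>v v2 = 0\<^sub>v 2"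
    then have "(a \<cdot>\<^sub>v v1 + b \<cdot>\<^sub>v v2) $ 0 = 0" "(a \<cdot>\<^sub>v v1 + b \<cdot>\<^sub>v v2) $ 1 = 0"
      by auto
    then show "a = 0 \<and> b = 0"
      using q by (auto simp: v_index[unfolded One_nat_def] carrier_vecD[OF carrier(1)] carrier_vecD[OF carrier(2)])
  qed
  have "T k *\<^sub>v v1 = vec_nth z k \<cdot>\<^sub>v v1 \<and> T k *\<^sub>v v2 = vec_nth w k \<cdot>\<^sub>v v2" for k
    using q by (intro conjI vec2_eqI mult_mat_vec_carrier[of _ 2 2] smult_carrier_vec[THEN iffD2])
      (auto simp: T_index[unfolded One_nat_def] v_index[unfolded One_nat_def] carrier_vecD[OF carrier(1)] carrier_vecD[OF carrier(2)] algebra_simps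
        simp del: index_mult_mat_vec)
  then have diag: "diagonalizes T v1 v2 z w"
    using indep by (simp add: diagonalizes_def)
  moreover have "T k * T l = T l * T k" for k l
    by (intro eq_matI)
      (auto simp: T_def scalar_prod_def less_2_cases_iff numeral_2_eq_2 algebra_simps)
  ultimately have "diagonalizable T"
    by (auto simp: diagonalizable_def commuting_tuple_def)
  moreover have "vnorm v1 = 1" "vnorm v2 = 1"
    using q c by (simp_all add: vnorm_def L2_set_def v1_def v2_def numeral_2_eq_2 lessThan_Suc)
  moreover have "v1 \<bullet>c v2 = of_real c"
    by (simp add: cscalar_prod_sum v_index[unfolded One_nat_def] carrier_vecD[OF carrier(2)] numeral_2_eq_2 lessThan_Suc)
  ultimately show ?thesis
    using diagonalizes_imp_diagonalized[OF diag] by auto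
qed

section \<open>Holomorphic matrix functions\<close>

text \<open>Entries of matrix expressions have their usual formulas only where the dimensions are
  known, that is on \<Omega>. The closure lemmas for matrix functions pass from formula to entry in
  this way.\<close>

lemma holomorphic_several_cong:
  assumes "holomorphic_several g \<Omega>" "\<And>z. z \<in> \<Omega> \<Longrightarrow> f z = g z"
  shows "holomorphic_several f \<Omega>"
  unfolding holomorphic_several_def
proof (intro conjI ballI)
  show "open \<Omega>"
    using assms(1) by (simp add: holomorphic_several_def)
  fix z assume z: "z \<in> \<Omega>"
  then obtain D where D: "(g has_derivative D) (at z)" "\<forall>c h. D (c *s h) = c * D h"
    using assms(1) by (auto simp: holomorphic_several_def)
  have "(f has_derivative D) (at z)"
    by (rule has_derivative_transform_within_open[OF D(1) \<open>open \<Omega>\<close> z]) (simp add: assms(2))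
  with D(2) show "\<exists>D. (f has_derivative D) (at z) \<and> (\<forall>c h. D (c *s h) = c * D h)"
    by blast
qed

lemma holomorphic_several_const: "open \<Omega> \<Longrightarrow> holomorphic_several (\<lambda>_. c) \<Omega>"
  unfolding holomorphic_several_def by (auto intro!: exI[of _ "\<lambda>_. 0"])

lemma holomorphic_several_add:
  assumes "holomorphic_several f \<Omega>" "holomorphic_several g \<Omega>"
  shows "holomorphic_several (\<lambda>z. f z + g z) \<Omega>"
  unfolding holomorphic_several_def
proof (intro conjI ballI)
  show "open \<Omega>"
    using assms(1) by (simp add: holomorphic_several_def)
  fix z assume z: "z \<in> \<Omega>"
  obtain F where F: "(f has_derivative F) (at z)" "\<forall>c h. F (c *s h) = c * F h"
    using assms(1) z by (auto simp: holomorphic_several_def)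
  obtain G where G: "(g has_derivative G) (at z)" "\<forall>c h. G (c *s h) = c * G h"
    using assms(2) z by (auto simp: holomorphic_several_def)
  show "\<exists>D. ((\<lambda>z. f z + g z) has_derivative D) (at z) \<and> (\<forall>c h. D (c *s h) = c * D h)"
    using has_derivative_add[OF F(1) G(1)] F(2) G(2)
    by (intro exI[of _ "\<lambda>h. F h + G h"]) (auto simp: distrib_left)
qed

lemma holomorphic_several_mult:
  assumes "holomorphic_several f \<Omega>" "holomorphic_several g \<Omega>"
  shows "holomorphic_several (\<lambda>z. f z * g z) \<Omega>"
  unfolding holomorphic_several_def
proof (intro conjI ballI)
  show "open \<Omega>"
    using assms(1) by (simp add: holomorphic_several_def)
  fix z assume z: "z \<in> \<Omega>"
  obtain F where F: "(f has_derivative F) (at z)" "\<forall>c h. F (c *s h) = c * F h"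
    using assms(1) z by (auto simp: holomorphic_several_def)
  obtain G where G: "(g has_derivative G) (at z)" "\<forall>c h. G (c *s h) = c * G h"
    using assms(2) z by (auto simp: holomorphic_several_def)
  show "\<exists>D. ((\<lambda>z. f z * g z) has_derivative D) (at z) \<and> (\<forall>c h. D (c *s h) = c * D h)"
    using has_derivative_mult[OF F(1) G(1)] F(2) G(2)
    by (intro exI[of _ "\<lambda>h. f z * G h + F h * g z"]) (auto simp: algebra_simps)
qed

lemma holomorphic_several_inverse:
  assumes "holomorphic_several f \<Omega>" "\<And>z. z \<in> \<Omega> \<Longrightarrow> f z \<noteq> 0"
  shows "holomorphic_several (\<lambda>z. inverse (f z)) \<Omega>"
  unfolding holomorphic_several_def
proof (intro conjI ballI)
  show "open \<Omega>"
    using assms(1) by (simp add: holomorphic_several_def)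
  fix z assume z: "z \<in> \<Omega>"
  obtain F where F: "(f has_derivative F) (at z)" "\<forall>c h. F (c *s h) = c * F h"
    using assms(1) z by (auto simp: holomorphic_several_def)
  show "\<exists>D. ((\<lambda>z. inverse (f z)) has_derivative D) (at z) \<and> (\<forall>c h. D (c *s h) = c * D h)"
    using Deriv.has_derivative_inverse[OF assms(2)[OF z] F(1)] F(2)
    by (intro exI[of _ "\<lambda>h. - (inverse (f z) * F h * inverse (f z))"]) auto
qed

lemma holomorphic_several_sum:
  assumes "open \<Omega>" "\<And>i. i \<in> I \<Longrightarrow> holomorphic_several (f i) \<Omega>"
  shows "holomorphic_several (\<lambda>z. \<Sum>i\<in>I. f i z) \<Omega>"
  using assms(2)
  by (induction I rule: infinite_finite_induct)
    (auto intro!: holomorphic_several_const holomorphic_several_add assms(1))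

lemma holomorphic_several_prod:
  assumes "open \<Omega>" "\<And>i. i \<in> I \<Longrightarrow> holomorphic_several (f i) \<Omega>"
  shows "holomorphic_several (\<lambda>z. \<Prod>i\<in>I. f i z) \<Omega>"
  using assms(2)
  by (induction I rule: infinite_finite_induct)
    (auto intro!: holomorphic_several_const holomorphic_several_mult assms(1))

lemma holomorphic_several_subset:
  "holomorphic_several f \<Omega> \<Longrightarrow> open \<Omega>' \<Longrightarrow> \<Omega>' \<subseteq> \<Omega> \<Longrightarrow> holomorphic_several f \<Omega>'"
  by (auto simp: holomorphic_several_def)

lemma holomorphic_mat_subset:
  "holomorphic_mat m n F \<Omega> \<Longrightarrow> open \<Omega>' \<Longrightarrow> \<Omega>' \<subseteq> \<Omega> \<Longrightarrow> holomorphic_mat m n F \<Omega>'"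
  unfolding holomorphic_mat_def by (meson holomorphic_several_subset subsetD)

lemma holomorphic_mat_const: "open \<Omega> \<Longrightarrow> A \<in> carrier_mat m n \<Longrightarrow> holomorphic_mat m n (\<lambda>_. A) \<Omega>"
  by (simp add: holomorphic_mat_def holomorphic_several_const)

lemma holomorphic_mat_smult:
  assumes "open \<Omega>" "holomorphic_mat m n F \<Omega>"
  shows "holomorphic_mat m n (\<lambda>z. a \<cdot>\<^sub>m F z) \<Omega>"
  unfolding holomorphic_mat_def
proof (intro conjI ballI allI impI)
  fix i j assume ij: "i < m" "j < n"
  have "holomorphic_several (\<lambda>z. a * F z $$ (i, j)) \<Omega>"
    using assms ij unfolding holomorphic_mat_def
    by (intro holomorphic_several_mult holomorphic_several_const) auto
  then show "holomorphic_several (\<lambda>z. (a \<cdot>\<^sub>m F z) $$ (i, j)) \<Omega>"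
    by (rule holomorphic_several_cong) (use assms ij in \<open>auto simp: holomorphic_mat_def\<close>)
qed (use assms in \<open>auto simp: holomorphic_mat_def\<close>)

lemma holomorphic_mat_minus:
  assumes "open \<Omega>" "holomorphic_mat m n F \<Omega>" "holomorphic_mat m n G \<Omega>"
  shows "holomorphic_mat m n (\<lambda>z. F z - G z) \<Omega>"
  unfolding holomorphic_mat_def
proof (intro conjI ballI allI impI)
  fix i j assume ij: "i < m" "j < n"
  have "holomorphic_several (\<lambda>z. F z $$ (i, j) + (- 1) * G z $$ (i, j)) \<Omega>"
    using assms ij unfolding holomorphic_mat_def
    by (intro holomorphic_several_add holomorphic_several_mult holomorphic_several_const) auto
  then show "holomorphic_several (\<lambda>z. (F z - G z) $$ (i, j)) \<Omega>"
    by (rule holomorphic_several_cong) (use assms ij in \<open>auto simp: holomorphic_mat_def carrier_matD[of _ m n]\<close>)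
qed (use assms in \<open>auto simp: holomorphic_mat_def minus_carrier_mat\<close>)

lemma holomorphic_mat_mult:
  assumes "open \<Omega>" "holomorphic_mat m k F \<Omega>" "holomorphic_mat k n G \<Omega>"
  shows "holomorphic_mat m n (\<lambda>z. F z * G z) \<Omega>"
  unfolding holomorphic_mat_def
proof (intro conjI ballI allI impI)
  fix i j assume ij: "i < m" "j < n"
  have "holomorphic_several (\<lambda>z. \<Sum>l<k. F z $$ (i, l) * G z $$ (l, j)) \<Omega>"
    using assms ij unfolding holomorphic_mat_def
    by (intro holomorphic_several_sum holomorphic_several_mult) auto
  then show "holomorphic_several (\<lambda>z. (F z * G z) $$ (i, j)) \<Omega>"
    by (rule holomorphic_several_cong)
      (use assms ij in \<open>auto simp: holomorphic_mat_def mult_mat_index[of _ m k _ n] simp del: index_mult_mat(1)\<close>)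
qed (use assms in \<open>auto simp: holomorphic_mat_def intro: mult_carrier_mat\<close>)

section \<open>Determinants and inverses\<close>

lemma holomorphic_det:
  assumes "open \<Omega>" "holomorphic_mat n n F \<Omega>"
  shows "holomorphic_several (\<lambda>z. det (F z)) \<Omega>"
proof -
  have "holomorphic_several (\<lambda>z. \<Sum>p | p permutes {0..<n}. signof p * (\<Prod>i = 0..<n. F z $$ (i, p i))) \<Omega>"
  proof (intro holomorphic_several_sum holomorphic_several_mult holomorphic_several_const
      holomorphic_several_prod assms(1))
    fix p i assume "p \<in> {p. p permutes {0..<n}}" "i \<in> {0..<n}"
    then have "i < n" "p i < n"
      using permutes_in_image[of p "{0..<n}" i] by auto
    then show "holomorphic_several (\<lambda>z. F z $$ (i, p i)) \<Omega>"
      using assms(2) by (simp add: holomorphic_mat_def)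
  qed
  then show ?thesis
    by (rule holomorphic_several_cong) (use assms(2) in \<open>auto simp: holomorphic_mat_def det_def'\<close>)
qed

text \<open>This makes the entries of the inverse visibly rational in those of \<open>A\<close>,
  from which holomorphy can be read off.\<close>

lemma mat_inv_cofactor:
  fixes A :: "complex mat"
  assumes A: "A \<in> carrier_mat n n" and det: "det A \<noteq> 0"
  shows "mat_inv A \<in> carrier_mat n n"
    "\<And>i j. i < n \<Longrightarrow> j < n \<Longrightarrow> mat_inv A $$ (i, j) = inverse (det A) * cofactor A j i"
proof -
  have inj: "v = 0\<^sub>v n" if "v \<in> carrier_vec n" "A *\<^sub>v v = 0\<^sub>v n" for v
    using det_0_iff_vec_prod_zero_field[OF A] det that by blast
  note inv = mat_inv_injective[OF A inj]
  show "mat_inv A \<in> carrier_mat n n"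
    using inv by blast
  define B where "B = inverse (det A) \<cdot>\<^sub>m adj_mat A"
  note adj = adj_mat[OF A]
  have B: "B \<in> carrier_mat n n"
    using adj by (simp add: B_def)
  have "A * B = inverse (det A) \<cdot>\<^sub>m (det A \<cdot>\<^sub>m 1\<^sub>m n)"
    unfolding B_def using mult_smult_distrib[OF A adj(1)] adj(2) by simp
  also have "\<dots> = 1\<^sub>m n"
    using det by (intro eq_matI) auto
  finally have "A * B = 1\<^sub>m n" .
  then have "mat_inv A = mat_inv A * (A * B)"
    using inv by simp
  also have "\<dots> = B"
    using assoc_mult_mat[OF inv(1) A B] inv(3) B by simp
  finally show "mat_inv A $$ (i, j) = inverse (det A) * cofactor A j i" if "i < n" "j < n" for i j
    using that A adj(1) by (simp add: B_def adj_mat_def)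
qed

lemma holomorphic_mat_inv:
  assumes \<Omega>: "open \<Omega>" and F: "holomorphic_mat n n F \<Omega>" and det: "\<And>z. z \<in> \<Omega> \<Longrightarrow> det (F z) \<noteq> 0"
  shows "holomorphic_mat n n (\<lambda>z. mat_inv (F z)) \<Omega>"
  unfolding holomorphic_mat_def
proof (intro conjI ballI allI impI)
  have Fc: "F z \<in> carrier_mat n n" if "z \<in> \<Omega>" for z
    using F that by (simp add: holomorphic_mat_def)
  show "mat_inv (F z) \<in> carrier_mat n n" if "z \<in> \<Omega>" for z
    using mat_inv_cofactor(1)[OF Fc det] that by blast
  fix i j assume ij: "i < n" "j < n"
  have del: "holomorphic_mat (n - 1) (n - 1) (\<lambda>z. mat_delete (F z) j i) \<Omega>"
    unfolding holomorphic_mat_def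
  proof (intro conjI ballI allI impI)
    fix i' j' assume ij': "i' < n - 1" "j' < n - 1"
    then have "holomorphic_several (\<lambda>z. F z $$ (if i' < j then i' else Suc i', if j' < i then j' else Suc j')) \<Omega>"
      using F by (auto simp: holomorphic_mat_def)
    then show "holomorphic_several (\<lambda>z. mat_delete (F z) j i $$ (i', j')) \<Omega>"
      by (rule holomorphic_several_cong) (use Fc ij' in \<open>auto simp: mat_delete_def carrier_matD[of _ n n]\<close>)
  qed (use Fc mat_delete_carrier in blast)
  have "holomorphic_several (\<lambda>z. inverse (det (F z)) * ((-1) ^ (j + i) * det (mat_delete (F z) j i))) \<Omega>"
    by (intro holomorphic_several_mult holomorphic_several_inverse holomorphic_several_const
        holomorphic_det[OF \<Omega> F] holomorphic_det[OF \<Omega> del] \<Omega> det)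
  then show "holomorphic_several (\<lambda>z. mat_inv (F z) $$ (i, j)) \<Omega>"
    by (rule holomorphic_several_cong) (use ij mat_inv_cofactor(2)[OF Fc det] in \<open>auto simp: cofactor_def\<close>)
qed

section \<open>Comparison with the Moebius distance\<close>

text \<open>The scalar case of the identity for 1 - \<phi>* \<phi>, with denominators
  cleared.\<close>

lemma d_disk_identity:
  "(cmod (1 - cnj \<beta> * \<alpha>))\<^sup>2 - (cmod (\<alpha> - \<beta>))\<^sup>2 = (1 - (cmod \<alpha>)\<^sup>2) * (1 - (cmod \<beta>)\<^sup>2)"
  unfolding cmod_power2 by (simp add: power2_eq_square algebra_simps)

lemma disk_denominator_nonzero:
  assumes "cmod \<alpha> < 1" "cmod \<beta> < 1"
  shows "1 - cnj \<beta> * \<alpha> \<noteq> 0"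
proof
  assume "1 - cnj \<beta> * \<alpha> = 0"
  then have "cmod \<beta> * cmod \<alpha> = 1"
    by (metis complex_mod_cnj eq_iff_diff_eq_0 norm_mult norm_one)
  moreover have "cmod \<beta> * cmod \<alpha> < 1 * 1"
    using assms by (intro mult_strict_mono') auto
  ultimately show False by simp
qed

lemma d_disk_le_1:
  assumes "cmod \<alpha> < 1" "cmod \<beta> < 1"
  shows "d_disk \<alpha> \<beta> \<le> 1"
proof -
  have "0 \<le> (1 - (cmod \<alpha>)\<^sup>2) * (1 - (cmod \<beta>)\<^sup>2)"
    using assms by (intro mult_nonneg_nonneg) (auto simp: abs_square_le_1)
  then have "(cmod (\<alpha> - \<beta>))\<^sup>2 \<le> (cmod (1 - cnj \<beta> * \<alpha>))\<^sup>2"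
    using d_disk_identity[of \<beta> \<alpha>] by linarith
  then have "cmod (\<alpha> - \<beta>) \<le> cmod (1 - cnj \<beta> * \<alpha>)"
    by (rule power2_le_imp_le) simp
  then show ?thesis
    using disk_denominator_nonzero[OF assms] by (simp add: d_disk_def norm_divide)
qed

text \<open>The supremum is taken in the reals, so its members must first be bounded: both points
  lie in \<Omega>, where the functions take values in the disk, and 1 is a bound.\<close>

lemma d_disk_le_moebius_dist:
  assumes "holomorphic_several f \<Omega>" "f ` \<Omega> \<subseteq> ball 0 1" "z \<in> \<Omega>" "w \<in> \<Omega>"
  shows "d_disk (f z) (f w) \<le> moebius_dist \<Omega> z w"
  unfolding moebius_dist_def
proof (rule cSup_upper)
  show "bdd_above {d_disk (f z) (f w) |f. holomorphic_several f \<Omega> \<and> f ` \<Omega> \<subseteq> ball 0 1}"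
  proof (rule bdd_aboveI, clarify)
    fix f assume "f ` \<Omega> \<subseteq> ball (0::complex) 1"
    then show "d_disk (f z) (f w) \<le> 1"
      using assms(3,4) by (intro d_disk_le_1) (auto simp: image_subset_iff)
  qed
qed (use assms in blast)

lemma moebius_dist_le:
  assumes "open \<Omega>"
    and "\<And>f. holomorphic_several f \<Omega> \<Longrightarrow> f ` \<Omega> \<subseteq> ball 0 1 \<Longrightarrow> d_disk (f z) (f w) \<le> t"
  shows "moebius_dist \<Omega> z w \<le> t"
  unfolding moebius_dist_def
proof (rule cSup_least)
  have "holomorphic_several (\<lambda>_. 0) \<Omega> \<and> (\<lambda>_. 0) ` \<Omega> \<subseteq> ball (0::complex) 1"
    using assms(1) holomorphic_several_const by auto
  then show "{d_disk (f z) (f w) |f. holomorphic_several f \<Omega> \<and> f ` \<Omega> \<subseteq> ball 0 1} \<noteq> {}"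
    by blast
qed (use assms(2) in blast)

lemma moebius_dist_nonneg:
  assumes "open \<Omega>" "z \<in> \<Omega>" "w \<in> \<Omega>"
  shows "0 \<le> moebius_dist \<Omega> z w"
  using d_disk_le_moebius_dist[OF holomorphic_several_const[OF assms(1), of 0]] assms
  by (auto simp: d_disk_def image_subset_iff)

text \<open>With \<open>W\<close> fixed both square roots are constant, and the dependence on the
  point is through g - W and the inverse of I - W* g, whose determinant does not vanish.\<close>

lemma holomorphic_moebius_mat:
  assumes \<Omega>: "open \<Omega>" and g: "holomorphic_mat m n g \<Omega>"
    and lt: "\<And>\<zeta>. \<zeta> \<in> \<Omega> \<Longrightarrow> opnorm (g \<zeta>) < 1"
    and W: "W \<in> carrier_mat m n" "opnorm W < 1"
  shows "holomorphic_mat m n (\<lambda>\<zeta>. moebius_mat (g \<zeta>) W) \<Omega>"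
proof (cases "\<Omega> = {}")
  case True
  then show ?thesis
    by (simp add: holomorphic_mat_def holomorphic_several_def)
next
  case False
  have con: "strict_contractions m n (g \<zeta>) W" if "\<zeta> \<in> \<Omega>" for \<zeta>
    using that g lt W by (auto simp: holomorphic_mat_def strict_contractions_def)
  \<comment> \<open>The point gives access to the locale; the constant factors \<open>z.Si\<close>
    and \<open>z.R\<close> depend on \<open>W\<close> only.\<close>
  from False obtain z where "z \<in> \<Omega>" by blast
  then interpret z: strict_contractions m n "g z" W
    by (rule con)
  have det: "det (1\<^sub>m n - mat_adjoint W * g \<zeta>) \<noteq> 0" if "\<zeta> \<in> \<Omega>" for \<zeta>
    using strict_contractions.J(4)[OF con[OF that]] .
  note const = holomorphic_mat_const[OF \<Omega>] and mult = holomorphic_mat_mult[OF \<Omega>]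
    and minus = holomorphic_mat_minus[OF \<Omega>]
  have "holomorphic_mat n n (\<lambda>\<zeta>. mat_inv (1\<^sub>m n - mat_adjoint W * g \<zeta>)) \<Omega>"
    using holomorphic_mat_inv[OF \<Omega> minus[OF const[OF one_carrier_mat] mult[OF const[OF z.aW] g]] det] .
  moreover have "holomorphic_mat m n (\<lambda>\<zeta>. z.Si * (g \<zeta> - W)) \<Omega>"
    using mult[OF const[OF z.Si(1)] minus[OF g const[OF W(1)]]] .
  ultimately have "holomorphic_mat m n (\<lambda>\<zeta>. z.Si * (g \<zeta> - W) *
      mat_inv (1\<^sub>m n - mat_adjoint W * g \<zeta>) * z.R) \<Omega>"
    using mult const[OF z.R(1)] by blast
  then show ?thesis
    using W by (simp add: moebius_mat_def z.Si_def z.S_def z.R_def)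
qed

text \<open>The competitor for the supremum is \<open>\<langle>\<phi> x, p\<rangle> / (\<parallel>x\<parallel> \<parallel>p\<parallel>)\<close>, where \<open>\<phi>\<close> is the Moebius
  transformation of \<open>g\<close> that vanishes at \<open>w\<close> and \<open>p\<close> is the value of \<open>\<phi> x\<close> at \<open>z\<close>.\<close>

lemma d_Delta_le_moebius_dist:
  assumes \<Omega>: "open \<Omega>" and g: "holomorphic_mat m n g \<Omega>"
    and lt: "\<And>\<zeta>. \<zeta> \<in> \<Omega> \<Longrightarrow> opnorm (g \<zeta>) < 1"
    and z: "z \<in> \<Omega>" and w: "w \<in> \<Omega>"
  shows "d_Delta g z w \<le> moebius_dist \<Omega> z w"
proof -
  have gc: "g \<zeta> \<in> carrier_mat m n" if "\<zeta> \<in> \<Omega>" for \<zeta>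
    using g that by (simp add: holomorphic_mat_def)
  define F where "F \<zeta> = moebius_mat (g \<zeta>) (g w)" for \<zeta>
  have hol: "holomorphic_mat m n F \<Omega>"
    unfolding F_def using holomorphic_moebius_mat[OF \<Omega> g lt gc[OF w] lt[OF w]] .
  have con: "strict_contractions m n (g \<zeta>) (g w)" if "\<zeta> \<in> \<Omega>" for \<zeta>
    using that gc lt w by (auto simp: strict_contractions_def)
  have Fc: "F \<zeta> \<in> carrier_mat m n" if "\<zeta> \<in> \<Omega>" for \<zeta>
    using hol that by (simp add: holomorphic_mat_def)
  have "vnorm (F z *\<^sub>v x) \<le> moebius_dist \<Omega> z w * vnorm x" if x: "x \<in> carrier_vec n" for x
  proof (cases "vnorm (F z *\<^sub>v x) = 0")
    case True
    then show ?thesis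
      using moebius_dist_nonneg[OF \<Omega> z w] by simp
  next
    case False
    define p where "p = F z *\<^sub>v x"
    have p: "p \<in> carrier_vec m"
      using Fc[OF z] x by (auto simp: p_def)
    have "vnorm x \<noteq> 0"
      using False vnorm_mult_le_opnorm[OF Fc[OF z] x] vnorm_nonneg[of "F z *\<^sub>v x"]
      by (metis mult_zero_right order_antisym)
    then have x0: "x \<noteq> 0\<^sub>v n" and nx: "0 < vnorm x"
      using x by (auto simp: vnorm_eq_0_iff[of _ n] less_le)
    have np: "0 < vnorm p"
      using False by (simp add: p_def less_le)
    define h where "h \<zeta> = complex_of_real (1 / (vnorm x * vnorm p)) * ((F \<zeta> *\<^sub>v x) \<bullet>c p)" for \<zeta>
    have "holomorphic_several (\<lambda>\<zeta>. complex_of_real (1 / (vnorm x * vnorm p)) *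
        (\<Sum>i<m. (\<Sum>j<n. F \<zeta> $$ (i, j) * x $ j) * cnj (p $ i))) \<Omega>"
      using hol unfolding holomorphic_mat_def
      by (intro holomorphic_several_mult holomorphic_several_sum holomorphic_several_const \<Omega>) auto
    then have hol_h: "holomorphic_several h \<Omega>"
    proof (rule holomorphic_several_cong)
      fix \<zeta> assume "\<zeta> \<in> \<Omega>"
      from Fc[OF this] show "h \<zeta> = complex_of_real (1 / (vnorm x * vnorm p)) *
          (\<Sum>i<m. (\<Sum>j<n. F \<zeta> $$ (i, j) * x $ j) * cnj (p $ i))"
        using x p by (simp add: h_def cscalar_prod_sum mult_mat_vec_index[of _ m n] del: index_mult_mat_vec)
    qed
    have disk: "h \<zeta> \<in> ball 0 1" if \<zeta>: "\<zeta> \<in> \<Omega>" for \<zeta>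
    proof -
      have "cmod ((F \<zeta> *\<^sub>v x) \<bullet>c p) \<le> vnorm (F \<zeta> *\<^sub>v x) * vnorm p"
        using Fc[OF \<zeta>] x p by (intro cscalar_prod_Cauchy_Schwarz) auto
      \<comment> \<open>Strictness at each nonzero vector suffices here and puts \<open>h\<close>
        into the open disk.\<close>
      also have "\<dots> < vnorm x * vnorm p"
        using strict_contractions.moebius_mat_less[OF con[OF \<zeta>] x x0] np by (simp add: F_def)
      finally show ?thesis
        using nx np by (simp add: h_def norm_mult norm_divide)
    qed
    have "F w = 0\<^sub>m m n"
      using moebius_mat_self[OF gc[OF w] lt[OF w]] by (simp add: F_def)
    moreover have "0\<^sub>m m n *\<^sub>v x = 0\<^sub>v m"
      using x by (intro eq_vecI) auto
    ultimately have hw: "h w = 0"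
      using p by (simp add: h_def cscalar_prod_sum)
    \<comment> \<open>Pairing with p itself makes the value at z as large as Cauchy-Schwarz permits;
      since h vanishes at w, this ratio is the disk distance.\<close>
    have hz: "h z = of_real (vnorm p / vnorm x)"
      using np by (simp add: h_def p_def[symmetric] cscalar_prod_self power2_eq_square)
    have "d_disk (h z) (h w) \<le> moebius_dist \<Omega> z w"
      using disk by (intro d_disk_le_moebius_dist[OF hol_h _ z w]) blast
    then have "vnorm p / vnorm x \<le> moebius_dist \<Omega> z w"
      unfolding hw hz d_disk_def by (simp add: norm_divide)
    then show ?thesis
      using nx by (simp add: p_def divide_le_eq)
  qed
  then have "opnorm (F z) \<le> moebius_dist \<Omega> z w"
    using Fc[OF z] moebius_dist_nonneg[OF \<Omega> z w] by (subst opnorm_le_iff) (auto simp: norm_bound_def)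
  then show ?thesis
    by (simp add: d_Delta_eq_opnorm F_def)
qed

section \<open>Scalar functions and the disk\<close>

lemma scalar_block_imp_d_disk_le:
  fixes \<alpha> \<beta> :: complex
  assumes disk: "cmod \<alpha> < 1" "cmod \<beta> < 1"
    and block: "\<And>p q. (cmod (\<alpha> * p))\<^sup>2 + (cmod (\<beta> * q))\<^sup>2 + 2 * c * Re (\<alpha> * p * cnj (\<beta> * q))
      \<le> (cmod p)\<^sup>2 + (cmod q)\<^sup>2 + 2 * c * Re (p * cnj q)"
  shows "(d_disk \<alpha> \<beta>)\<^sup>2 \<le> 1 - c\<^sup>2"
proof -
  define k where "k = 1 - (cmod \<beta>)\<^sup>2"
  define u where "u = 1 - cnj \<beta> * \<alpha>"
  have k: "0 < k"
    using disk by (simp add: k_def abs_square_less_1)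
  have u: "u \<noteq> 0"
    unfolding u_def by (rule disk_denominator_nonzero[OF disk])
  \<comment> \<open>For given p the form is minimal at q = -c (1 - cnj \<beta> \<alpha>) p / (1 -
    |\<beta>|^2); taking p = 1 - |\<beta>|^2 clears the denominator.\<close>
  let ?p = "complex_of_real k" and ?q = "- of_real c * u"
  have "Re (?p * cnj ?q) - Re (\<alpha> * ?p * cnj (\<beta> * ?q)) = - (k * c) * Re ((1 - cnj \<beta> * \<alpha>) * cnj u)"
    by (simp add: algebra_simps)
  also have "\<dots> = - (k * c * (cmod u)\<^sup>2)"
    unfolding u_def[symmetric] by (simp add: complex_norm_square[symmetric] flip: of_real_power)
  finally have mixed: "Re (?p * cnj ?q) - Re (\<alpha> * ?p * cnj (\<beta> * ?q)) = - (k * c * (cmod u)\<^sup>2)" .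
  have norm_p: "(cmod ?p)\<^sup>2 - (cmod (\<alpha> * ?p))\<^sup>2 = k * (k * (1 - (cmod \<alpha>)\<^sup>2))"
    using k by (simp add: norm_mult power_mult_distrib power2_eq_square algebra_simps)
  have norm_q: "(cmod ?q)\<^sup>2 - (cmod (\<beta> * ?q))\<^sup>2 = k * (c\<^sup>2 * (cmod u)\<^sup>2)"
    by (simp add: norm_mult power_mult_distrib k_def algebra_simps)
  have "0 \<le> ((cmod ?p)\<^sup>2 - (cmod (\<alpha> * ?p))\<^sup>2) + ((cmod ?q)\<^sup>2 - (cmod (\<beta> * ?q))\<^sup>2) +
      2 * c * (Re (?p * cnj ?q) - Re (\<alpha> * ?p * cnj (\<beta> * ?q)))"
    using block[of ?p ?q] unfolding right_diff_distrib by linarith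
  then have "0 \<le> k * (k * (1 - (cmod \<alpha>)\<^sup>2) - c\<^sup>2 * (cmod u)\<^sup>2)"
    unfolding mixed norm_p norm_q by (simp add: algebra_simps power2_eq_square)
  then have "c\<^sup>2 * (cmod u)\<^sup>2 \<le> k * (1 - (cmod \<alpha>)\<^sup>2)"
    using k by (simp add: zero_le_mult_iff)
  then have "(cmod (\<alpha> - \<beta>))\<^sup>2 \<le> (1 - c\<^sup>2) * (cmod u)\<^sup>2"
    using d_disk_identity[of \<beta> \<alpha>] by (simp add: k_def u_def algebra_simps)
  then show ?thesis
    using u by (simp add: d_disk_def u_def[symmetric] norm_divide power_divide divide_le_eq)
qed

lemma vnorm_vec1: "vnorm (vec 1 (\<lambda>_. p)) = cmod p"
  by (simp add: vnorm_def L2_set_def)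

text \<open>A function into the disk is a 1 by 1 matrix function of norm at most 1, so the spectral
  property makes f(T) a contraction; on vectors of length 1 this is the scalar form.\<close>

lemma spectral_imp_d_disk_le:
  assumes d: "diagonalized T v1 v2 z w" "vnorm v1 = 1" "vnorm v2 = 1" "v1 \<bullet>c v2 = of_real c"
    and spectral: "complete_spectral_domain \<Omega> T"
    and f: "holomorphic_several f \<Omega>" "f ` \<Omega> \<subseteq> ball 0 1"
  shows "(d_disk (f z) (f w))\<^sup>2 \<le> 1 - c\<^sup>2"
proof -
  interpret diagonalized T v1 v2 z w
    by (rule d(1))
  have zw: "z \<in> \<Omega>" "w \<in> \<Omega>"
    using spectral joint_spectrum_eq by (auto simp: complete_spectral_domain_def)
  define F where "F \<zeta> = mat 1 1 (\<lambda>_. f \<zeta>)" for \<zeta>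
  have Fc: "F \<zeta> \<in> carrier_mat 1 1" for \<zeta>
    by (simp add: F_def)
  have Fv: "F \<zeta> *\<^sub>v vec 1 (\<lambda>_. p) = vec 1 (\<lambda>_. f \<zeta> * p)" for \<zeta> p
    by (intro eq_vecI) (auto simp: F_def scalar_prod_def)
  have "vnorm (F \<zeta> *\<^sub>v x) \<le> 1 * vnorm x" if \<zeta>: "\<zeta> \<in> \<Omega>" and x: "x \<in> carrier_vec 1" for \<zeta> x
  proof -
    have "x = vec 1 (\<lambda>_. x $ 0)"
      using x by (intro eq_vecI) auto
    moreover have "cmod (f \<zeta>) \<le> 1"
      using f(2) \<zeta> by (auto simp: image_subset_iff less_imp_le)
    then have "cmod (f \<zeta> * x $ 0) \<le> cmod (x $ 0)"
      by (simp add: norm_mult mult_left_le_one_le)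
    ultimately show ?thesis
      using Fv[of \<zeta> "x $ 0"] by (metis mult_1 vnorm_vec1)
  qed
  then have "opnorm (F \<zeta>) \<le> 1" if "\<zeta> \<in> \<Omega>" for \<zeta>
    using that Fc by (subst opnorm_le_iff) (auto intro!: norm_boundI[of _ 1 1])
  then have "(SUP \<zeta>\<in>\<Omega>. ereal (opnorm (F \<zeta>))) \<le> 1"
    by (intro SUP_least) simp
  moreover have "holomorphic_mat 1 1 F \<Omega>"
    using f(1) by (simp add: holomorphic_mat_def F_def)
  then have "ereal (opnorm (fun_calc 1 1 F T)) \<le> (SUP \<zeta>\<in>\<Omega>. ereal (opnorm (F \<zeta>)))"
    using spectral[unfolded complete_spectral_domain_def, THEN conjunct2, THEN conjunct2,
        rule_format, of 1 F] by simp
  ultimately have "ereal (opnorm (fun_calc 1 1 F T)) \<le> 1"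
    by (rule order_trans[rotated])
  then have "opnorm (fun_calc 1 1 F T) \<le> 1"
    by simp
  then have block: "(vnorm (F z *\<^sub>v e1))\<^sup>2 + (vnorm (F w *\<^sub>v e2))\<^sup>2 + 2 * c * Re ((F z *\<^sub>v e1) \<bullet>c (F w *\<^sub>v e2))
     \<le> 1\<^sup>2 * ((vnorm e1)\<^sup>2 + (vnorm e2)\<^sup>2 + 2 * c * Re (e1 \<bullet>c e2))"
    if "e1 \<in> carrier_vec 1" "e2 \<in> carrier_vec 1" for e1 e2
    using that opnorm_fun_calc_le_iff[where G = F, OF Fc Fc zero_le_one d(2-4)] by blast
  show ?thesis
  proof (rule scalar_block_imp_d_disk_le)
    show "cmod (f z) < 1" "cmod (f w) < 1"
      using f(2) zw by (auto simp: image_subset_iff)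
    have cscalar_vec1: "vec 1 (\<lambda>_. p) \<bullet>c vec 1 (\<lambda>_. q) = p * cnj q" for p q :: complex
      by (simp add: cscalar_prod_sum)
    show "(cmod (f z * p))\<^sup>2 + (cmod (f w * q))\<^sup>2 + 2 * c * Re (f z * p * cnj (f w * q))
      \<le> (cmod p)\<^sup>2 + (cmod q)\<^sup>2 + 2 * c * Re (p * cnj q)" for p q
      using block[of "vec 1 (\<lambda>_. p)" "vec 1 (\<lambda>_. q)"] unfolding Fv vnorm_vec1 cscalar_vec1 by simp
  qed
qed

text \<open>Both sides express the same quadratic inequality, one through the eigenvectors of T and
  the other through the Moebius transform.\<close>

lemma opnorm_fun_calc_le_1_iff:
  assumes d: "diagonalized T v1 v2 z w" "vnorm v1 = 1" "vnorm v2 = 1" "v1 \<bullet>c v2 = of_real c"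
    and c: "0 \<le> c" "c \<le> 1"
    and G: "strict_contractions m n (G z) (G w)"
  shows "opnorm (fun_calc m n G T) \<le> 1 \<longleftrightarrow> (d_Delta G z w)\<^sup>2 \<le> 1 - c\<^sup>2"
proof -
  interpret diagonalized T v1 v2 z w
    by (rule d(1))
  interpret strict_contractions m n "G z" "G w"
    by (rule G)
  show ?thesis
    using opnorm_fun_calc_le_iff[OF Z W zero_le_one d(2-4)] block_contractive_iff[OF c]
    by (simp add: block_contractive_def d_Delta_eq_opnorm)
qed

text \<open>Homogeneity of the calculus, obtained from the quadratic criterion: replacing G by G / t
  divides its left side by t^2.\<close>

lemma opnorm_fun_calc_rescale:
  assumes d: "diagonalized T v1 v2 z w" "vnorm v1 = 1" "vnorm v2 = 1" "v1 \<bullet>c v2 = of_real c"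
    and G: "G z \<in> carrier_mat m n" "G w \<in> carrier_mat m n" and t: "0 < t"
    and le: "opnorm (fun_calc m n (\<lambda>\<zeta>. inverse (of_real t) \<cdot>\<^sub>m G \<zeta>) T) \<le> 1"
  shows "opnorm (fun_calc m n G T) \<le> t"
proof -
  interpret diagonalized T v1 v2 z w
    by (rule d(1))
  let ?a = "complex_of_real (inverse t)"
  have "0 \<le> t"
    using t by simp
  show ?thesis
    unfolding opnorm_fun_calc_le_iff[OF G \<open>0 \<le> t\<close> d(2-4)]
  proof (intro ballI)
    fix e1 e2 :: "complex vec" assume e: "e1 \<in> carrier_vec n" "e2 \<in> carrier_vec n"
    have smult: "(inverse (of_real t) \<cdot>\<^sub>m A) *\<^sub>v e = ?a \<cdot>\<^sub>v (A *\<^sub>v e)"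
      if "A \<in> carrier_mat m n" "e \<in> carrier_vec n" for A e
      using that by (intro eq_vecI) (auto simp: scalar_prod_def sum_distrib_left mult.assoc)
    have Ge: "G z *\<^sub>v e1 \<in> carrier_vec m" "G w *\<^sub>v e2 \<in> carrier_vec m"
      using G e by auto
    let ?rhs = "(vnorm e1)\<^sup>2 + (vnorm e2)\<^sup>2 + 2 * c * Re (e1 \<bullet>c e2)"
    let ?lhs = "(vnorm (G z *\<^sub>v e1))\<^sup>2 + (vnorm (G w *\<^sub>v e2))\<^sup>2 +
        2 * c * Re ((G z *\<^sub>v e1) \<bullet>c (G w *\<^sub>v e2))"
    have "inverse (of_real t) \<cdot>\<^sub>m G z \<in> carrier_mat m n" "inverse (of_real t) \<cdot>\<^sub>m G w \<in> carrier_mat m n"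
      using G by auto
    from opnorm_fun_calc_le_iff[where G = "\<lambda>\<zeta>. inverse (of_real t) \<cdot>\<^sub>m G \<zeta>", OF this zero_le_one d(2-4)] le e
    have "(vnorm (?a \<cdot>\<^sub>v (G z *\<^sub>v e1)))\<^sup>2 + (vnorm (?a \<cdot>\<^sub>v (G w *\<^sub>v e2)))\<^sup>2 +
        2 * c * Re ((?a \<cdot>\<^sub>v (G z *\<^sub>v e1)) \<bullet>c (?a \<cdot>\<^sub>v (G w *\<^sub>v e2))) \<le> 1\<^sup>2 * ?rhs"
      unfolding smult[OF G(1) e(1), symmetric] smult[OF G(2) e(2), symmetric] by blast
    also have "(vnorm (?a \<cdot>\<^sub>v (G z *\<^sub>v e1)))\<^sup>2 + (vnorm (?a \<cdot>\<^sub>v (G w *\<^sub>v e2)))\<^sup>2 +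
        2 * c * Re ((?a \<cdot>\<^sub>v (G z *\<^sub>v e1)) \<bullet>c (?a \<cdot>\<^sub>v (G w *\<^sub>v e2))) = ?lhs / t\<^sup>2"
      using Ge t
      by (simp add: vnorm_smult cscalar_prod_smult_left[of _ m] cscalar_prod_smult_right[of _ m]
          norm_inverse power_mult_distrib) (simp add: power2_eq_square power4_eq_xxxx field_simps)
    finally show "?lhs \<le> t\<^sup>2 * ?rhs"
      using t by (simp add: divide_le_eq mult.commute)
  qed
qed

theorem theorem1p2:
  fixes E :: "(complex ^ 'd) set"
    and \<Delta> :: "complex ^ 'd \<Rightarrow> complex mat"
    and s r :: nat
  assumes "0 < s" and "0 < r"
    and "open E"
    and "holomorphic_mat s r \<Delta> E"
    and "is_domain (B_Delta E \<Delta>)"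
    and "\<exists>z\<in>B_Delta E \<Delta>. \<exists>w\<in>B_Delta E \<Delta>. z \<noteq> w"
  shows "(\<forall>z\<in>B_Delta E \<Delta>. \<forall>w\<in>B_Delta E \<Delta>. d_Delta \<Delta> z w = moebius_dist (B_Delta E \<Delta>) z w)
     \<longleftrightarrow>
     (\<forall>T :: 'd \<Rightarrow> complex mat.
        diagonalizable T \<and> joint_spectrum T \<subseteq> B_Delta E \<Delta> \<and> opnorm (fun_calc s r \<Delta> T) \<le> 1
        \<longrightarrow> complete_spectral_domain (B_Delta E \<Delta>) T)"
proof -
  let ?B = "B_Delta E \<Delta>"
  have B: "open ?B"
    using assms by (simp add: is_domain_def)
  have hol: "holomorphic_mat s r \<Delta> ?B"
    by (rule holomorphic_mat_subset[OF assms(4) B]) (auto simp: B_Delta_def)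
  have lt: "opnorm (\<Delta> \<zeta>) < 1" if "\<zeta> \<in> ?B" for \<zeta>
    using that by (simp add: B_Delta_def)
  have con: "strict_contractions s r (\<Delta> z) (\<Delta> w)" if "z \<in> ?B" "w \<in> ?B" for z w
    using that hol lt by (auto simp: holomorphic_mat_def strict_contractions_def)
  show ?thesis
  proof (intro iffI allI impI ballI; (elim conjE)?)
    fix T :: "'d \<Rightarrow> complex mat"
    assume eq: "\<forall>z\<in>?B. \<forall>w\<in>?B. d_Delta \<Delta> z w = moebius_dist ?B z w"
      and T: "diagonalizable T" "joint_spectrum T \<subseteq> ?B" "opnorm (fun_calc s r \<Delta> T) \<le> 1"
    obtain v1 v2 z w c where d: "diagonalized T v1 v2 z w" "vnorm v1 = 1" "vnorm v2 = 1"
      "v1 \<bullet>c v2 = of_real c" and c: "0 \<le> c" "c < 1"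
      using normalized_diagonalization[OF T(1)] by blast
    have c1: "c \<le> 1"
      using c by simp
    have zw: "z \<in> ?B" "w \<in> ?B"
      using T(2) diagonalized.joint_spectrum_eq[OF d(1)] by auto
    have le: "(d_Delta \<Delta> z w)\<^sup>2 \<le> 1 - c\<^sup>2"
      using opnorm_fun_calc_le_1_iff[where G = \<Delta>, OF d c(1) c1 con[OF zw]] T(3) by blast
    have "ereal (opnorm (fun_calc n n f T)) \<le> (SUP \<zeta>\<in>?B. ereal (opnorm (f \<zeta>)))"
      if f: "holomorphic_mat n n f ?B" for n f
    proof (rule ccontr)
      assume "\<not> ?thesis"
      then have "(SUP \<zeta>\<in>?B. ereal (opnorm (f \<zeta>))) < ereal (opnorm (fun_calc n n f T))"
        by (simp add: not_le)
      \<comment> \<open>An infinite supremum is excluded by the assumption to be refuted. A real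
        \<open>t\<close> strictly above it makes f / t strictly contractive at every point, as the
        Moebius transform requires.\<close>
      from ereal_dense2[OF this] obtain t where
        t: "(SUP \<zeta>\<in>?B. ereal (opnorm (f \<zeta>))) < ereal t" "t < opnorm (fun_calc n n f T)"
        by auto
      have less: "opnorm (f \<zeta>) < t" if "\<zeta> \<in> ?B" for \<zeta>
        using that t(1) by (meson SUP_upper ereal_less_eq(3) le_less_trans less_ereal.simps(1))
      have t0: "0 < t"
        using less[OF zw(1)] opnorm_nonneg[of "f z"] by linarith
      define g where "g = (\<lambda>\<zeta>. inverse (complex_of_real t) \<cdot>\<^sub>m f \<zeta>)"
      have fc: "f \<zeta> \<in> carrier_mat n n" if "\<zeta> \<in> ?B" for \<zeta>
        using f that by (simp add: holomorphic_mat_def)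
      have g: "holomorphic_mat n n g ?B"
        unfolding g_def by (rule holomorphic_mat_smult[OF B f])
      have g_lt: "opnorm (g \<zeta>) < 1" if "\<zeta> \<in> ?B" for \<zeta>
      proof -
        have "opnorm (g \<zeta>) \<le> opnorm (f \<zeta>) / t"
          using opnorm_smult[OF fc[OF that], of "inverse (complex_of_real t)"] t0
          by (simp add: g_def norm_inverse divide_inverse mult.commute)
        also have "\<dots> < 1"
          using less[OF that] t0 by simp
        finally show ?thesis .
      qed
      have g_con: "strict_contractions n n (g z) (g w)"
        using g g_lt zw by (auto simp: holomorphic_mat_def strict_contractions_def)
      \<comment> \<open>The Moebius distance mediates: it dominates the distance of g, and by
        hypothesis it equals that of \<Delta>.\<close>
      have "d_Delta g z w \<le> d_Delta \<Delta> z w"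
        using d_Delta_le_moebius_dist[OF B g g_lt zw] eq zw by simp
      then have "(d_Delta g z w)\<^sup>2 \<le> (d_Delta \<Delta> z w)\<^sup>2"
        by (intro power_mono) (auto simp: d_Delta_eq_opnorm)
      then have "opnorm (fun_calc n n g T) \<le> 1"
        using opnorm_fun_calc_le_1_iff[where G = g, OF d c(1) c1 g_con] le by linarith
      then have "opnorm (fun_calc n n f T) \<le> t"
        using opnorm_fun_calc_rescale[where G = f, OF d fc[OF zw(1)] fc[OF zw(2)] t0, folded g_def] by simp
      then show False
        using t(2) by simp
    qed
    then show "complete_spectral_domain ?B T"
      using T(2) assms(5) by (simp add: complete_spectral_domain_def)
  next
    fix z w
    assume spectral: "\<forall>T :: 'd \<Rightarrow> complex mat. diagonalizable T \<and> joint_spectrum T \<subseteq> ?B \<and>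
        opnorm (fun_calc s r \<Delta> T) \<le> 1 \<longrightarrow> complete_spectral_domain ?B T"
      and zw: "z \<in> ?B" "w \<in> ?B"
    have d_nonneg: "0 \<le> d_Delta \<Delta> z w"
      by (simp add: d_Delta_eq_opnorm)
    have "moebius_dist ?B z w \<le> d_Delta \<Delta> z w"
    proof (rule moebius_dist_le[OF B], rule ccontr)
      fix f assume f: "holomorphic_several f ?B" "f ` ?B \<subseteq> ball 0 1"
        and "\<not> d_disk (f z) (f w) \<le> d_Delta \<Delta> z w"
      then obtain e where e: "d_Delta \<Delta> z w < e" "e < d_disk (f z) (f w)"
        using dense[of "d_Delta \<Delta> z w" "d_disk (f z) (f w)"] by auto
      have "d_disk (f z) (f w) \<le> 1"
        using f(2) zw by (intro d_disk_le_1) (auto simp: image_subset_iff)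
      with e d_nonneg have e01: "0 < e" "e < 1"
        by auto
      \<comment> \<open>The angle whose threshold sqrt(1 - c^2) is e. It is admissible because e
        lies strictly between 0 and 1; e > 0 is what gives c < 1, hence independent
        eigenvectors.\<close>
      define c where "c = sqrt (1 - e\<^sup>2)"
      have "e\<^sup>2 < 1" "0 < e\<^sup>2"
        using e01 by (auto simp: abs_square_less_1)
      then have c: "0 \<le> c" "c < 1" "c \<le> 1" "1 - c\<^sup>2 = e\<^sup>2"
        by (auto simp: c_def)
      obtain T :: "'d \<Rightarrow> complex mat" and v1 v2 where T: "diagonalizable T" and
        d: "diagonalized T v1 v2 z w" "vnorm v1 = 1" "vnorm v2 = 1" "v1 \<bullet>c v2 = of_real c"
        using diagonalizable_with_angle[OF c(1,2)] by blast
      have "(d_Delta \<Delta> z w)\<^sup>2 \<le> e\<^sup>2"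
        using e(1) d_nonneg by (intro power_mono) auto
      then have "opnorm (fun_calc s r \<Delta> T) \<le> 1"
        using opnorm_fun_calc_le_1_iff[where G = \<Delta>, OF d c(1,3) con[OF zw]] c(4) by simp
      then have "complete_spectral_domain ?B T"
        using spectral T zw diagonalized.joint_spectrum_eq[OF d(1)] by auto
      from spectral_imp_d_disk_le[OF d this f] have "(d_disk (f z) (f w))\<^sup>2 \<le> e\<^sup>2"
        using c(4) by simp
      then have "d_disk (f z) (f w) \<le> e"
        using e01 by (auto intro: power2_le_imp_le)
      then show False
        using e(2) by simp
    qed
    \<comment> \<open>The opposite inequality is the general one, applied to \<Delta>
      itself.\<close>
    then show "d_Delta \<Delta> z w = moebius_dist ?B z w"
      using d_Delta_le_moebius_dist[OF B hol lt zw] by simp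
  qed
qed

end
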